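(* Let $f_0,f_1$ be the transformations of $\{x_0,x_1\}^{\omega}$ defined by the automaton $\mathcal{I}_2$, let $S$ be the semigroup they generate, and for each integer $n\ge 1$ let $S_n$ be the semigroup generated by the restrictions of $f_0,f_1$ to $\{x_0,x_1\}^n$ (all as in the context). (1) The semigroup $S$ is a monoid, and it has the (monoid) presentation $$S=\left\langle f_0,f_1 \;\middle|\; f_0^2=1;\ \ f_1(f_0f_1)^p(f_1f_0)^pf_1^2=f_1(f_0f_1)^p(f_1f_0)^p,\ p\ge 0\right\rangle .$$ The monoid $S$ is infinitely presented (i.e. it is not finitely presented), and its word problem is solvable in polynomial time. (2) For every integer $n\ge 1$, the semigroup $S_n$ has the (monoid) presentation $$S_n=\left\langle f_0,f_1 \;\middle|\; \begin{array}{l} f_0^2=1;\\ f_1(f_0f_1)^p(f_1f_0)^pf_1^2=f_1(f_0f_1)^p(f_1f_0)^p,\quad 0\le p\le n-2;\\ f_1(f_0f_1)^{n-1}f_1=f_1(f_0f_1)^{n-1}f_0=f_1(f_0f_1)^{n-1}\end{array}\right\rangle .$$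
   Context: The automaton $\mathcal{I}_2$ is the $2$-state Mealy automaton over the alphabet $\{x_0,x_1\}$ whose two states define the following transformations $f_0,f_1$ of the set of finite words $\{x_0,x_1\}^*$ and of the set of (right-)infinite words $\{x_0,x_1\}^{\omega}$, given recursively, for every word $u$, by $$f_0(x_0u)=x_1f_0(u),\quad f_0(x_1u)=x_0f_0(u),\quad f_1(x_0u)=x_1f_1(u),\quad f_1(x_1u)=x_1f_0(u),$$ with $f_i(\varepsilon)=\varepsilon$ for the empty word. These maps preserve length and common prefixes. Products are compositions with the right factor applied first: $(fg)(u)=f(g(u))$; and $f^0=1$ is the identity map. $S$ is the semigroup generated by $f_0,f_1$ under composition as transformations of $\{x_0,x_1\}^{\omega}$ (equivalently, of $\{x_0,x_1\}^*$). For $n\ge1$, $S_n$ is the quotient of $S$ given by its action on words of length $n$, i.e. the semigroup of maps $\{x_0,x_1\}^n\to\{x_0,x_1\}^n$ generated by the restrictions of $f_0$ and $f_1$ (still denoted $f_0,f_1$). The word problem asks, given two words over the letters $f_0,f_1$, to decide whether they represent the same element of $S$; "polynomial time" is in terms of the lengths of the two words. *)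

theory Defs
  imports "HOL-Algebra.Group" "HOL-Library.Stream"
begin

section \<open>The automaton\<close>

datatype letter = X0 | X1

datatype state = F0 | F1

fun output_letter :: "state \<Rightarrow> letter \<Rightarrow> letter" where
  "output_letter F0 X0 = X1"
| "output_letter F0 X1 = X0"
| "output_letter F1 X0 = X1"
| "output_letter F1 X1 = X1"

fun next_state :: "state \<Rightarrow> letter \<Rightarrow> state" where
  "next_state F0 X0 = F0"
| "next_state F0 X1 = F0"
| "next_state F1 X0 = F1"
| "next_state F1 X1 = F0"

primcorec act :: "state \<Rightarrow> letter stream \<Rightarrow> letter stream" where
  "shd (act q u) = output_letter q (shd u)"
| "stl (act q u) = act (next_state q (shd u)) (stl u)"

primrec act_fin :: "state \<Rightarrow> letter list \<Rightarrow> letter list" where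
  "act_fin q [] = []"
| "act_fin q (x # u) = output_letter q x # act_fin (next_state q x) u"

lemma act_recursion:
  "act F0 (X0 ## u) = X1 ## act F0 u"
  "act F0 (X1 ## u) = X0 ## act F0 u"
  "act F1 (X0 ## u) = X1 ## act F1 u"
  "act F1 (X1 ## u) = X1 ## act F0 u"
  by (subst act.ctr; simp)+

lemma act_fin_recursion:
  "act_fin F0 (X0 # v) = X1 # act_fin F0 v"
  "act_fin F0 (X1 # v) = X0 # act_fin F0 v"
  "act_fin F1 (X0 # v) = X1 # act_fin F1 v"
  "act_fin F1 (X1 # v) = X1 # act_fin F0 v"
  by simp_all

inductive_set generated_semigroup :: "('a \<Rightarrow> 'a \<Rightarrow> 'a) \<Rightarrow> 'a set \<Rightarrow> 'a set"
  for m :: "'a \<Rightarrow> 'a \<Rightarrow> 'a" and A :: "'a set" where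
  generator: "a \<in> A \<Longrightarrow> a \<in> generated_semigroup m A"
| product: "a \<in> generated_semigroup m A \<Longrightarrow> b \<in> generated_semigroup m A \<Longrightarrow>
    m a b \<in> generated_semigroup m A"

text \<open>The carrier consists of the nonempty products of generators only. That the identity map, which
  is entered as the unit of the record, lies in it is part of the assertion
  \<^term>\<open>monoid automaton_semigroup\<close>.\<close>

definition automaton_semigroup :: "(letter stream \<Rightarrow> letter stream) monoid" where
  "automaton_semigroup =
    \<lparr>carrier = generated_semigroup (\<circ>) (range act), mult = (\<circ>), one = id\<rparr>"

definition words_of_length :: "nat \<Rightarrow> letter list set" where
  "words_of_length n = {u. length u = n}"

text \<open>Self-maps of \<^term>\<open>words_of_length n\<close> are represented by their extensional total versions.\<close>

definition act_level :: "nat \<Rightarrow> state \<Rightarrow> letter list \<Rightarrow> letter list" where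
  "act_level n q = restrict (act_fin q) (words_of_length n)"

definition level_semigroup :: "nat \<Rightarrow> (letter list \<Rightarrow> letter list) monoid" where
  "level_semigroup n =
    \<lparr>carrier = generated_semigroup (compose (words_of_length n)) (range (act_level n)),
     mult = compose (words_of_length n),
     one = restrict id (words_of_length n)\<rparr>"

section \<open>Monoid presentations\<close>

inductive_set generated_congruence :: "'x set \<Rightarrow> ('x list \<times> 'x list) set \<Rightarrow> ('x list \<times> 'x list) set"
  for X :: "'x set" and R :: "('x list \<times> 'x list) set" where
  relation: "(u, v) \<in> R \<Longrightarrow> (u, v) \<in> generated_congruence X R"
| reflexive: "u \<in> lists X \<Longrightarrow> (u, u) \<in> generated_congruence X R"
| symmetric: "(u, v) \<in> generated_congruence X R \<Longrightarrow> (v, u) \<in> generated_congruence X R"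
| transitive: "(u, v) \<in> generated_congruence X R \<Longrightarrow> (v, w) \<in> generated_congruence X R \<Longrightarrow>
    (u, w) \<in> generated_congruence X R"
| compatible: "(u, v) \<in> generated_congruence X R \<Longrightarrow> (u', v') \<in> generated_congruence X R \<Longrightarrow>
    (u @ u', v @ v') \<in> generated_congruence X R"

definition presented_monoid :: "'x set \<Rightarrow> ('x list \<times> 'x list) set \<Rightarrow> 'x list set monoid" where
  "presented_monoid X R =
    \<lparr>carrier = lists X // generated_congruence X R,
     mult = (\<lambda>A B. \<Union>a\<in>A. \<Union>b\<in>B. generated_congruence X R `` {a @ b}),
     one = generated_congruence X R `` {[]}\<rparr>"

text \<open>\<open>M\<close> is presented by generators \<open>X\<close> and relations \<open>R\<close>, the symbol \<open>x\<close> naming the element \<open>g x\<close>.\<close>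

definition has_presentation ::
    "('a, 'b) monoid_scheme \<Rightarrow> ('x \<Rightarrow> 'a) \<Rightarrow> 'x set \<Rightarrow> ('x list \<times> 'x list) set \<Rightarrow> bool" where
  "has_presentation M g X R \<longleftrightarrow>
    monoid M \<and> R \<subseteq> lists X \<times> lists X \<and>
    (\<exists>\<phi> \<in> iso (presented_monoid X R) M. \<forall>x\<in>X. \<phi> (generated_congruence X R `` {[x]}) = g x)"

text \<open>Natural numbers serve as names for the generators, which is no restriction since there are
  finitely many.\<close>

definition finitely_presented :: "('a, 'b) monoid_scheme \<Rightarrow> bool" where
  "finitely_presented M \<longleftrightarrow>
    (\<exists>(X :: nat set) R g. finite X \<and> finite R \<and> has_presentation M g X R)"

fun word_power :: "'x list \<Rightarrow> nat \<Rightarrow> 'x list" where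
  "word_power w 0 = []"
| "word_power w (Suc p) = w @ word_power w p"

section \<open>Polynomial time\<close>

text \<open>Deterministic Turing machines with any fixed number of two-way infinite tapes. States and
  symbols are initial segments of the natural numbers, and symbol 0 is the blank. A tape
  \<open>(l, r)\<close> has the head on the first cell of \<open>r\<close>; \<open>l\<close> holds the cells to the left of the
  head, nearest first; all cells beyond both lists are blank.\<close>

datatype move = Move_Left | Stay | Move_Right

type_synonym tape = "nat list \<times> nat list"

definition top_symbol :: "nat list \<Rightarrow> nat" where
  "top_symbol xs = (case xs of [] \<Rightarrow> 0 | x # _ \<Rightarrow> x)"

definition read_tape :: "tape \<Rightarrow> nat" where
  "read_tape t = top_symbol (snd t)"

fun write_tape :: "nat \<Rightarrow> tape \<Rightarrow> tape" where
  "write_tape s (l, r) = (l, s # tl r)"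

fun move_head :: "move \<Rightarrow> tape \<Rightarrow> tape" where
  "move_head Move_Left (l, r) = (tl l, top_symbol l # r)"
| "move_head Stay (l, r) = (l, r)"
| "move_head Move_Right (l, r) = (top_symbol r # l, tl r)"

record machine =
  tape_count :: nat
  state_count :: nat
  symbol_count :: nat
  start :: nat
  accept :: nat
  reject :: nat
  delta :: "nat \<Rightarrow> nat list \<Rightarrow> nat \<times> (nat \<times> move) list"

definition turing_machine :: "machine \<Rightarrow> bool" where
  "turing_machine T \<longleftrightarrow>
    tape_count T > 0 \<and> symbol_count T > 0 \<and>
    start T < state_count T \<and> accept T < state_count T \<and> reject T < state_count T \<and>
    accept T \<noteq> reject T \<and>
    (\<forall>q < state_count T. \<forall>ss. length ss = tape_count T \<and> set ss \<subseteq> {..<symbol_count T} \<longrightarrow>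
      fst (delta T q ss) < state_count T \<and>
      length (snd (delta T q ss)) = tape_count T \<and>
      (\<forall>(s, m) \<in> set (snd (delta T q ss)). s < symbol_count T))"

type_synonym configuration = "nat \<times> tape list"

definition initial :: "machine \<Rightarrow> nat list \<Rightarrow> configuration" where
  "initial T w = (start T, ([], w) # replicate (tape_count T - 1) ([], []))"

fun step :: "machine \<Rightarrow> configuration \<Rightarrow> configuration" where
  "step T (q, ts) =
    (if q = accept T \<or> q = reject T then (q, ts)
     else (case delta T q (map read_tape ts) of
       (q', as) \<Rightarrow> (q', map2 (\<lambda>(s, m) t. move_head m (write_tape s t)) as ts)))"

text \<open>The decision problem with positive instances \<open>P\<close>, where the instance \<open>i\<close> is written on the
  tape as \<open>enc i\<close> and has size \<open>sz i\<close>.\<close>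

definition decidable_in_polynomial_time ::
    "('i \<Rightarrow> nat list) \<Rightarrow> ('i \<Rightarrow> nat) \<Rightarrow> 'i set \<Rightarrow> bool" where
  "decidable_in_polynomial_time enc sz P \<longleftrightarrow>
    (\<exists>T c d. turing_machine T \<and>
      (\<forall>i. set (enc i) \<subseteq> {0<..<symbol_count T} \<and>
        (\<exists>t \<le> c * sz i ^ d + c.
          fst ((step T ^^ t) (initial T (enc i))) = (if i \<in> P then accept T else reject T))))"

section \<open>The word problem\<close>

definition word_value :: "('a, 'b) monoid_scheme \<Rightarrow> ('x \<Rightarrow> 'a) \<Rightarrow> 'x list \<Rightarrow> 'a" where
  "word_value M g w = foldr (\<lambda>x a. g x \<otimes>\<^bsub>M\<^esub> a) w \<one>\<^bsub>M\<^esub>"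

definition word_problem :: "('a, 'b) monoid_scheme \<Rightarrow> ('x \<Rightarrow> 'a) \<Rightarrow> ('x list \<times> 'x list) set" where
  "word_problem M g = {(u, v). word_value M g u = word_value M g v}"

fun symbol_code :: "state \<Rightarrow> nat" where
  "symbol_code F0 = 1"
| "symbol_code F1 = 2"

definition encode_pair :: "state list \<times> state list \<Rightarrow> nat list" where
  "encode_pair = (\<lambda>(u, v). map symbol_code u @ [3] @ map symbol_code v)"

definition pair_size :: "state list \<times> state list \<Rightarrow> nat" where
  "pair_size = (\<lambda>(u, v). length u + length v)"

end

theory Submission
  imports Defs
begin

text \<open>
  Put \<open>b = f0 f1\<close> and \<open>c = f1 f0\<close>. On words, \<open>f0\<close> exchanges the two letters, \<open>b\<close> turns the first
  \<open>X1\<close> into \<open>X0\<close>, and \<open>c\<close> turns the first \<open>X0\<close> into \<open>X1\<close>. As \<open>f1 = c f0 = f0 b\<close>, every product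
  of \<open>f0\<close> and \<open>f1\<close>, read from left to right, becomes a word in \<open>b\<close> and \<open>c\<close> followed by a power of
  \<open>f0\<close>: each letter changes a parity, and each \<open>f1\<close> contributes \<open>c\<close> or \<open>b\<close> according to the parity
  before it. The word in \<open>b\<close> and \<open>c\<close> is a walk on the integers, \<open>b\<close> stepping down and \<open>c\<close>
  stepping up. A step out of the interval visited so far is a record.

  The parity, the sequence \<open>r\<close> of directions of the records, and the distances from the final position
  to the two ends of the visited interval together determine the map, by the formula of
  \<open>apply_word_track\<close>: the image of a long word \<open>u\<close> is \<open>r\<close> followed by what remains of \<open>u\<close> (with its
  letters exchanged if the parity is odd) after deleting as many first \<open>X0\<close>s and first \<open>X1\<close>s as the
  two distances say. If \<open>r\<close> is shorter than the level, these data can be recovered from the map, and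
  otherwise the map is constant with value a prefix of \<open>r\<close> (\<open>apply_word_level_eq_iff\<close>). So \<open>S\<close> is
  the set of histories of walks with a parity, and in \<open>S\<^sub>n\<close> all those with the same first \<open>n\<close> records
  are identified.

  The relations say that a step inside the visited interval can be undone: in terms of \<open>b\<close> and
  \<open>c\<close> they become \<open>x\<^sup>p\<^sup>+\<^sup>1 y\<^sup>p\<^sup>+\<^sup>1 x = x\<^sup>p\<^sup>+\<^sup>1 y\<^sup>p\<close> with \<open>{x, y} = {b, c}\<close> (\<open>turn_relation\<close>). Hence every
  word is congruent to a standard walk with the same history (\<open>eqv_normal_word\<close>). The two additional
  relations of \<open>S\<^sub>n\<close> make a word with \<open>n\<close> records absorb everything on its right (\<open>eqv_sweep\<close>).

  If \<open>S\<close> were finitely presented, finitely many of the given relations would suffice. They do not: the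
  number of times a word, acting on a word of length \<open>n\<close>, applies \<open>f1\<close> to a word without \<open>X1\<close> is
  respected by the relations with \<open>p < n\<close>, but not by the one with \<open>p = n\<close>
  (\<open>relator_notin_truncated\<close>).

  Finally, a walk is easy to follow: a Turing machine can keep the two distances on unary counters
  and the records on a tape, for both input words, and compare the results in linear time
  (\<open>comparer_correct\<close>).
\<close>

section \<open>Words as walks\<close>

fun opposite :: "letter \<Rightarrow> letter" where
  "opposite X0 = X1"
| "opposite X1 = X0"

lemma opposite_opposite [simp]: "opposite (opposite x) = x"
  by (cases x) auto

lemma opposite_neq [simp]: "opposite x \<noteq> x" "x \<noteq> opposite x"
  by (cases x; simp)+

lemma neq_iff_opposite: "x \<noteq> y \<longleftrightarrow> x = opposite y"
  by (cases x; cases y) auto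

lemma opposite_involution [simp]: "opposite \<circ> opposite = id"
  by (rule ext) simp

lemma letter_fun_eq_iff: "f = g \<longleftrightarrow> f X0 = g X0 \<and> f X1 = g X1"
  unfolding fun_eq_iff by (metis letter.exhaust)

text \<open>A history \<open>(r, d)\<close> of a walk consists of the directions \<open>r\<close> of its records in order of time and of
the distances: \<open>d x\<close> is the number of steps in direction \<open>x\<close> that stay in the visited interval.
Direction \<open>X0\<close> is a step by \<open>f0 f1\<close>, direction \<open>X1\<close> a step by \<open>f1 f0\<close>; each is named by the letter
that the step writes.\<close>

type_synonym history = "letter list \<times> (letter \<Rightarrow> nat)"

definition dec :: "letter \<Rightarrow> nat \<Rightarrow> (letter \<Rightarrow> nat) \<Rightarrow> letter \<Rightarrow> nat" where
  "dec x a d = (\<lambda>y. if y = x then d y - a else d y)"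

definition inc :: "letter \<Rightarrow> (letter \<Rightarrow> nat) \<Rightarrow> letter \<Rightarrow> nat" where
  "inc x d = (\<lambda>y. if y = x then Suc (d y) else d y)"

lemma dec_apply: "dec x a d y = (if y = x then d y - a else d y)"
  by (simp add: dec_def)

lemma inc_apply: "inc x d y = (if y = x then Suc (d y) else d y)"
  by (simp add: inc_def)

lemma dec_same [simp]: "dec x a d x = d x - a"
  and dec_opposite [simp]: "dec x a d (opposite x) = d (opposite x)"
  and inc_same [simp]: "inc x d x = Suc (d x)"
  and inc_opposite [simp]: "inc (opposite x) d x = d x"
  by (simp_all add: dec_apply inc_apply)

lemma dec_X0_X1 [simp]: "dec X0 a d X1 = d X1" "dec X1 a d X0 = d X0"
  by (simp_all add: dec_apply)

lemma dec_dec [simp]: "dec x a (dec x b d) = dec x (a + b) d"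
  by (rule ext) (simp add: dec_apply add.commute)

lemma dec_inc [simp]: "dec x (Suc 0) (inc x d) = d"
  by (rule ext) (simp add: dec_apply inc_apply)

lemma dec_idle: "d x = 0 \<Longrightarrow> dec x a d = d"
  by (rule ext) (simp add: dec_apply)

lemma inc_dec_opposite: "inc (opposite x) (dec x a d) = dec x a (inc (opposite x) d)"
  by (rule ext) (simp add: dec_apply inc_apply)

lemma dec_inc_opposite: "dec (opposite x) (Suc 0) (dec x a (inc (opposite x) d)) = dec x a d"
  by (rule ext) (simp add: dec_apply inc_apply)

text \<open>After a record \<open>d x\<close> remains \<open>0\<close>, because the end of the interval has moved along; this is what
the truncated subtraction in \<open>dec\<close> gives.\<close>

primrec walk :: "letter \<Rightarrow> history \<Rightarrow> history" where
  "walk x (r, d) =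
    ((if d x = 0 then r @ [x] else r),
     inc (opposite x) (dec x 1 d))"

primrec track_step :: "history \<times> bool \<Rightarrow> state \<Rightarrow> history \<times> bool" where
  "track_step (h, e) = (\<lambda>q. case q of F0 \<Rightarrow> (h, \<not> e) | F1 \<Rightarrow> (walk (if e then X0 else X1) h, \<not> e))"

definition track :: "state list \<Rightarrow> history \<times> bool" where
  "track w = foldl track_step (([], \<lambda>_. 0), False) w"

lemma track_Nil [simp]: "track [] = (([], \<lambda>_. 0), False)"
  by (simp add: track_def)

lemma track_snoc [simp]: "track (w @ [q]) = track_step (track w) q"
  by (simp add: track_def)

lemma track_cases:
  obtains r d e where "track w = ((r, d), e)"
  by (cases "track w"; cases "fst (track w)") auto

definition records :: "state list \<Rightarrow> letter list" where
  "records w = fst (fst (track w))"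

section \<open>The action of a word in terms of its walk\<close>

definition apply_word :: "state list \<Rightarrow> letter list \<Rightarrow> letter list" where
  "apply_word w u = foldr act_fin w u"

lemma apply_word_simps [simp]:
  "apply_word [] u = u"
  "apply_word (q # w) u = act_fin q (apply_word w u)"
  "apply_word (w @ v) u = apply_word w (apply_word v u)"
  by (auto simp: apply_word_def)

lemma length_act_fin [simp]: "length (act_fin q u) = length u"
  by (induction u arbitrary: q) auto

lemma length_apply_word [simp]: "length (apply_word w u) = length u"
  by (induction w) auto

lemma act_fin_F0: "act_fin F0 u = map opposite u"
proof (induction u)
  case (Cons x u) then show ?case by (cases x) auto
qed simp

fun fill :: "letter \<Rightarrow> letter list \<Rightarrow> letter list" where
  "fill x [] = []"
| "fill x (y # u) = x # (if y = x then fill x u else u)"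

lemma act_fin_F1: "act_fin F1 u = fill X1 (map opposite u)"
proof (induction u)
  case (Cons x u) then show ?case by (cases x) (auto simp: act_fin_F0)
qed simp

lemma map_opposite_fill: "map opposite (fill x u) = fill (opposite x) (map opposite u)"
  by (induction u) (auto simp: neq_iff_opposite)

lemma length_fill [simp]: "length (fill x u) = length u"
  by (induction u) auto

text \<open>Applying \<open>fill x\<close> to a word amounts to deleting its first \<open>opposite x\<close> and
putting \<open>x\<close> in front. Iterated, this leaves a prefix followed by the input without some of its first letters.\<close>

primrec delete_first :: "(letter \<Rightarrow> nat) \<Rightarrow> letter list \<Rightarrow> letter list" where
  "delete_first d [] = []"
| "delete_first d (y # u) = (if d y = 0 then y # delete_first d u else delete_first (dec y 1 d) u)"

lemma delete_first_replicate:
  "delete_first d (replicate a y @ z) = replicate (a - d y) y @ delete_first (dec y a d) z"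
proof (induction a arbitrary: d)
  case 0
  have "dec y 0 d = d" by (rule ext) (simp add: dec_apply)
  then show ?case by simp
next
  case (Suc a)
  then show ?case by (cases "d y = 0") (auto simp: Suc_diff_Suc dec_idle)
qed

lemma delete_first_zero [simp]: "(\<And>x. d x = 0) \<Longrightarrow> delete_first d u = u"
  by (induction u) auto

lemma delete_first_all: "delete_first d (replicate (d x) x @ replicate (d (opposite x)) (opposite x) @ z) = z"
proof -
  have "dec (opposite x) (d (opposite x)) (dec x (d x) d) y = 0" for y
    by (cases "y = x") (auto simp: neq_iff_opposite dec_apply)
  then show ?thesis by (simp add: delete_first_replicate)
qed

definition flip :: "bool \<Rightarrow> letter list \<Rightarrow> letter list" where
  "flip e u = (if e then map opposite u else u)"

definition total :: "(letter \<Rightarrow> nat) \<Rightarrow> nat" where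
  "total d = d X0 + d X1"

lemma total_eq: "total d = d x + d (opposite x)"
  by (cases x) (auto simp: total_def)

text \<open>One step of the walk. The letter that \<open>fill x\<close> puts in front is either deleted at once, which saves one
deletion of \<open>x\<close>, or it survives as a new record. The truncation is needed because \<open>fill x\<close> does nothing
to a word without \<open>opposite x\<close>, so that the two sides have different lengths for such a word.\<close>

lemma delete_first_fill:
  "take (length u - total d) (delete_first d (fill x u)) =
   take (length u - total d)
     ((if d x = 0 then [x] else []) @ delete_first (inc (opposite x) (dec x 1 d)) u)"
proof (induction u arbitrary: d)
  case Nil
  then show ?case by simp
next
  case (Cons y u)
  show ?case
  proof (cases "y = x")
    case False
    then have y: "y = opposite x" by (simp add: neq_iff_opposite)
    have "delete_first (inc (opposite x) (dec x 1 d)) (y # u) = delete_first (dec x 1 d) u"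
      using y by (simp add: inc_dec_opposite dec_inc_opposite)
    then show ?thesis using y
      by (cases "length (y # u) - total d") (auto simp: dec_idle Suc_diff_le split: nat_diff_split)
  next
    case True
    show ?thesis
    proof (cases "d x = 0")
      case dx: True
      have k: "length (y # u) - total d = Suc (length u - total d) \<or> length (y # u) - total d = 0"
        by auto
      show ?thesis using k Cons.IH[of d] True dx
        by (auto simp: dec_idle inc_dec_opposite)
    next
      case dx: False
      have t: "total d = Suc (total (dec x 1 d))" using dx by (simp add: total_eq[of _ x])
      have "delete_first (inc (opposite x) (dec x 1 d)) (y # u) =
        (if d x = 1 then [x] else []) @ delete_first (inc (opposite x) (dec x 1 (dec x 1 d))) u"
      proof (cases "d x = 1")
        case True
        then have "dec x 1 (dec x 1 d) = dec x 1 d" by (intro dec_idle) simp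
        then show ?thesis using \<open>y = x\<close> True by (simp add: inc_dec_opposite del: dec_dec)
      next
        case False
        then show ?thesis using \<open>y = x\<close> dx by (simp add: inc_dec_opposite)
      qed
      moreover have "(dec x 1 d) x = 0 \<longleftrightarrow> d x = 1" using dx by auto
      ultimately show ?thesis using Cons.IH[of "dec x 1 d"] True dx
        by (simp add: t del: take_append dec_dec)
    qed
  qed
qed

lemma take_append_total:
  assumes "length r = m" "take (n - m) a = take (n - m) b"
  shows "take n (r @ a) = take n (r @ b)"
  using assms by simp

lemma total_walk:
  "total (snd (walk x (r, d))) = total d + (if d x = 0 then 1 else 0)"
  by (auto simp: total_eq[of _ x])

text \<open>The visited interval grows by one at each record.\<close>

lemma total_track: "total (snd (fst (track w))) = length (records w)"
proof (induction w rule: rev_induct)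
  case Nil
  then show ?case by (simp add: total_def records_def)
next
  case (snoc q w)
  obtain r d e where "track w = ((r, d), e)" by (rule track_cases)
  then show ?case
    using snoc total_walk[of _ r d] by (cases q) (auto simp: records_def)
qed

text \<open>The right-most letter of \<open>w\<close> acts first on \<open>u\<close>, but is the last step of the walk; the induction
therefore splits off the last letter and lets the rest of \<open>w\<close> act on the image of \<open>u\<close>.\<close>

theorem apply_word_track:
  assumes "track w = ((r, d), e)"
  shows "apply_word w u = take (length u) (r @ delete_first d (flip e u))"
  using assms
proof (induction w arbitrary: u r d e rule: rev_induct)
  case Nil
  then show ?case by (auto simp: flip_def)
next
  case (snoc q w)
  obtain r' d' e' where w: "track w = ((r', d'), e')" by (rule track_cases)
  have len: "length r' = total d'"
    using total_track[of w] w by (simp add: records_def)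
  have IH: "apply_word (w @ [q]) u = take (length u) (r' @ delete_first d' (flip e' (act_fin q u)))"
    using snoc.IH[OF w] by simp
  show ?case
  proof (cases q)
    case F0
    have "flip e' (act_fin F0 u) = flip (\<not> e') u"
      by (auto simp: flip_def act_fin_F0)
    then show ?thesis using IH snoc.prems w F0 by auto
  next
    case F1
    let ?x = "if e' then X0 else X1"
    have f: "flip e' (act_fin F1 u) = fill ?x (flip (\<not> e') u)"
      by (auto simp: flip_def act_fin_F1 map_opposite_fill)
    have l: "length (flip (\<not> e') u) = length u" by (simp add: flip_def)
    show ?thesis
      using take_append_total[OF len, OF delete_first_fill[of "flip (\<not> e') u" d' ?x, unfolded l]]
        IH snoc.prems w F1 f by auto
  qed
qed

lemma apply_word_const:
  assumes "length u \<le> length (records w)"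
  shows "apply_word w u = take (length u) (records w)"
proof -
  obtain r d e where w: "track w = ((r, d), e)" by (rule track_cases)
  show ?thesis using apply_word_track[OF w] w assms by (simp add: records_def)
qed

lemma flip_flip [simp]: "flip e (flip e u) = u"
  by (auto simp: flip_def)

lemma length_flip [simp]: "length (flip e u) = length u"
  by (auto simp: flip_def)

text \<open>The input consists of exactly the letters to be deleted, followed by an arbitrary tail. This makes
the image of \<open>w\<close> the set of all words with prefix \<open>r\<close>.\<close>

lemma apply_word_onto:
  assumes "track w = ((r, d), e)"
  shows "apply_word w (flip e (replicate (d x) x @ replicate (d (opposite x)) (opposite x) @ z)) = r @ z"
proof -
  have "length r = d x + d (opposite x)"
    using total_track[of w] assms by (simp add: records_def total_eq[of d x])
  then show ?thesis
    using apply_word_track[OF assms] by (simp add: delete_first_all)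
qed

text \<open>The image of \<open>v\<close> lies in the words with prefix \<open>records v\<close> (or is a single word), so \<open>records v\<close> cannot be
longer than the common prefix of the image of \<open>w\<close>.\<close>

lemma records_eq_of_apply_word_eq:
  assumes eq: "\<And>u. length u = n \<Longrightarrow> apply_word w u = apply_word v u"
    and lt: "length (records w) < n"
  shows "length (records v) \<le> length (records w) \<and>
    take (length (records v)) (records w) = records v"
proof -
  obtain r d e where w: "track w = ((r, d), e)" by (rule track_cases)
  obtain r' d' e' where v: "track v = ((r', d'), e')" by (rule track_cases)
  have rw: "records w = r" "records v = r'" using w v by (auto simp: records_def)
  have len: "length r = d X0 + d X1"
    using total_track[of w] w by (simp add: records_def total_def)
  have "take (length r') r @ take (length r' - length r) (replicate (n - length r) x)
    = take n r'" for x
  proof -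
    let ?u = "flip e (replicate (d X0) X0 @ replicate (d X1) X1 @ replicate (n - length r) x)"
    have l: "length ?u = n" using lt len rw by simp
    have "take (length r') (apply_word v ?u) = take n r'"
      using apply_word_track[OF v, of ?u] l by (simp add: min_def)
    moreover have "apply_word v ?u = r @ replicate (n - length r) x"
      using eq[OF l] apply_word_onto[OF w, of X0 "replicate (n - length r) x"] by simp
    ultimately show ?thesis by (metis take_append)
  qed
  note * = this
  have "length r' \<le> length r"
  proof (rule ccontr)
    assume a: "\<not> ?thesis"
    have "take (length r' - length r) (replicate (n - length r) X0) =
      take (length r' - length r) (replicate (n - length r) X1)"
      using *[of X0] *[of X1] by (metis append_same_eq same_append_eq)
    moreover have "0 < min (length r' - length r) (n - length r)" using a lt rw by auto
    ultimately show False by (cases "min (length r' - length r) (n - length r)") (auto simp: min_def split: if_splits)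
  qed
  then show ?thesis using *[of X0] lt rw by simp
qed

lemma track_eq_of_apply_word_eq:
  assumes eq: "\<And>u. length u = n \<Longrightarrow> apply_word w u = apply_word v u"
    and lt: "length (records w) < n"
  shows "track w = track v"
proof -
  obtain r d e where w: "track w = ((r, d), e)" by (rule track_cases)
  obtain r' d' e' where v: "track v = ((r', d'), e')" by (rule track_cases)
  have rw: "records w = r" "records v = r'" using w v by (auto simp: records_def)
  have 1: "length (records v) \<le> length (records w)" "take (length (records v)) (records w) = records v"
    using records_eq_of_apply_word_eq[OF eq lt] by auto
  have "length (records v) < n" using 1(1) lt by simp
  from records_eq_of_apply_word_eq[OF eq[symmetric] this]
  have "length (records w) \<le> length (records v)" by blast
  then have r: "r' = r" using 1 unfolding rw by simp
  have len: "length r = d X0 + d X1" "length r = d' X0 + d' X1"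
    using total_track[of w] total_track[of v] w v r by (auto simp: records_def total_def)
  define m where "m = n - length r"
  have m: "m > 0" using lt rw by (simp add: m_def)
  have *: "take m (delete_first d' (flip e' (flip e (replicate (d X0) X0 @ replicate (d X1) X1 @ replicate m x))))
     = replicate m x" for x
  proof -
    let ?u = "flip e (replicate (d X0) X0 @ replicate (d X1) X1 @ replicate m x)"
    have l: "length ?u = n" using lt len rw by (simp add: m_def)
    have "apply_word v ?u = r @ replicate m x"
      using eq[OF l] apply_word_onto[OF w, of X0 "replicate m x"] by simp
    moreover have "apply_word v ?u = take n (r @ delete_first d' (flip e' ?u))"
      using apply_word_track[OF v, of ?u] unfolding l r .
    moreover have "length r < n" using lt rw by simp
    ultimately show ?thesis unfolding m_def by simp
  qed
  obtain m' where m': "m = Suc m'" using m by (cases m) auto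
  have lead: "k = 0 \<or> y = x" if "take m (replicate k y @ z) = replicate m x" for k x y z
    using that m' by (cases k) auto
  have "e' = e"
  proof (rule ccontr)
    assume ne: "e' \<noteq> e"
    \<comment> \<open>With different parities the blocks to be deleted meet the wrong counters; unless the
      distances are interchanged, one of their letters survives in front.\<close>
    then have f: "flip e' (flip e u) = map opposite u" for u by (cases e; cases e') (auto simp: flip_def)
    have **: "take m (replicate (d X0 - d' X1) X1 @ replicate (d X1 - d' X0) X0 @
      delete_first (dec X0 (d X1) (dec X1 (d X0) d')) (replicate m (opposite x))) = replicate m x" for x
      using *[of x] by (simp add: f delete_first_replicate)
    have z1: "d X0 - d' X1 = 0" using lead[OF **[of X0]] by simp
    have z2: "d X1 - d' X0 = 0"
      using lead[OF **[of X1, unfolded z1 replicate_0 append_Nil]] by simp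
    have "d' X1 - d X0 = 0" "d' X0 - d X1 = 0" using z1 z2 len by auto
    then have "dec X0 (d X1) (dec X1 (d X0) d') y = 0" for y
      by (cases y) (auto simp: dec_apply)
    then have z3: "delete_first (dec X0 (d X1) (dec X1 (d X0) d')) z = z" for z
      by (rule delete_first_zero)
    show False using **[of X0, unfolded z1 z2 z3] m' by simp
  qed
  have **: "take m (replicate (d X0 - d' X0) X0 @ replicate (d X1 - d' X1) X1 @
      delete_first (dec X1 (d X1) (dec X0 (d X0) d')) (replicate m x)) = replicate m x" for x
    using *[of x] \<open>e' = e\<close> by (simp add: delete_first_replicate)
  have z1: "d X0 - d' X0 = 0" using lead[OF **[of X1]] by simp
  have z2: "d X1 - d' X1 = 0"
    using lead[OF **[of X0, unfolded z1 replicate_0 append_Nil]] by simp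
  have "d' X0 = d X0" "d' X1 = d X1" using z1 z2 len by auto
  then have "d' = d" by (intro ext) (metis letter.exhaust)
  then show ?thesis using w v r \<open>e' = e\<close> by simp
qed

text \<open>Faithfulness: two words act alike on level \<open>n\<close> only if they have the same history and parity, or are
both constant there.\<close>

lemma apply_word_level_eq_iff:
  "(\<forall>u. length u = n \<longrightarrow> apply_word w u = apply_word v u) \<longleftrightarrow>
   track w = track v \<or>
   (n \<le> length (records w) \<and> n \<le> length (records v) \<and> take n (records w) = take n (records v))"
  (is "?L \<longleftrightarrow> ?R")
proof
  assume L: ?L
  show ?R
  proof (cases "length (records w) < n \<or> length (records v) < n")
    case True
    then show ?thesis
      by (metis L track_eq_of_apply_word_eq)
  next
    case False
    moreover have "take n (records w) = take n (records v)"
      using L[rule_format, of "replicate n X0"] False by (simp add: apply_word_const)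
    ultimately show ?thesis by simp
  qed
next
  assume R: ?R
  show ?L
  proof (cases "track w = track v")
    case True
    obtain r d e where "track w = ((r, d), e)" by (rule track_cases)
    then show ?thesis using True by (simp add: apply_word_track)
  next
    case False
    then show ?thesis using R by (auto simp: apply_word_const)
  qed
qed

section \<open>Presentations in terms of words\<close>

lemma word_value_simps [simp]:
  "word_value M g [] = \<one>\<^bsub>M\<^esub>"
  "word_value M g (x # w) = g x \<otimes>\<^bsub>M\<^esub> word_value M g w"
  by (simp_all add: word_value_def)

lemma word_value_closed:
  assumes "monoid M" "g ` X \<subseteq> carrier M" "w \<in> lists X"
  shows "word_value M g w \<in> carrier M"
  using assms(3) assms(2)
  by (induction rule: lists.induct) (auto intro: monoid.m_closed[OF assms(1)] monoid.one_closed[OF assms(1)])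

lemma word_value_append:
  assumes "monoid M" "g ` X \<subseteq> carrier M" "u \<in> lists X" "v \<in> lists X"
  shows "word_value M g (u @ v) = word_value M g u \<otimes>\<^bsub>M\<^esub> word_value M g v"
  using assms(3)
proof (induction rule: lists.induct)
  case Nil
  then show ?case
    by (simp add: monoid.l_one[OF assms(1)] word_value_closed[OF assms(1,2,4)])
next
  case (Cons x u)
  have "g x \<in> carrier M" using assms(2) Cons.hyps by auto
  with Cons show ?case
    using word_value_closed[OF assms(1,2)] assms(4)
    by (simp add: monoid.m_assoc[OF assms(1)])
qed

lemma generated_congruence_lists:
  assumes "R \<subseteq> lists X \<times> lists X" "(u, v) \<in> generated_congruence X R"
  shows "u \<in> lists X \<and> v \<in> lists X"
  using assms(2)
  by (induction rule: generated_congruence.induct) (use assms(1) in auto)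

lemma equiv_generated_congruence:
  assumes "R \<subseteq> lists X \<times> lists X"
  shows "equiv (lists X) (generated_congruence X R)"
proof (rule equivI)
  show "generated_congruence X R \<subseteq> lists X \<times> lists X"
    using generated_congruence_lists[OF assms] by auto
  show "refl_on (lists X) (generated_congruence X R)"
    by (auto simp: refl_on_def intro: generated_congruence.reflexive)
  show "sym (generated_congruence X R)"
    by (auto simp: sym_def intro: generated_congruence.symmetric)
  show "trans (generated_congruence X R)"
    by (auto simp: trans_def intro: generated_congruence.transitive)
qed

lemma presented_monoid_mult:
  assumes "R \<subseteq> lists X \<times> lists X" "u \<in> lists X" "v \<in> lists X"
  shows "(generated_congruence X R `` {u}) \<otimes>\<^bsub>presented_monoid X R\<^esub> (generated_congruence X R `` {v})
    = generated_congruence X R `` {u @ v}"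
proof -
  note E = equiv_generated_congruence[OF assms(1)]
  have "generated_congruence X R `` {a @ b} = generated_congruence X R `` {u @ v}"
    if "a \<in> generated_congruence X R `` {u}" "b \<in> generated_congruence X R `` {v}" for a b
  proof -
    have "(u @ v, a @ b) \<in> generated_congruence X R"
      using that by (auto intro: generated_congruence.compatible)
    then show ?thesis using equiv_class_eq[OF E] by blast
  qed
  then have "(\<Union>a \<in> generated_congruence X R `` {u}. \<Union>b \<in> generated_congruence X R `` {v}.
      generated_congruence X R `` {a @ b}) =
    (\<Union>a \<in> generated_congruence X R `` {u}. \<Union>b \<in> generated_congruence X R `` {v}.
      generated_congruence X R `` {u @ v})"
    by (intro SUP_cong refl)
  moreover have "generated_congruence X R `` {u} \<noteq> {}" "generated_congruence X R `` {v} \<noteq> {}"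
    using generated_congruence.reflexive[OF assms(2)] generated_congruence.reflexive[OF assms(3)]
    by blast+
  ultimately show ?thesis by (simp add: presented_monoid_def)
qed

lemma has_presentationI:
  assumes M: "monoid M" and R: "R \<subseteq> lists X \<times> lists X" and g: "g ` X \<subseteq> carrier M"
    and onto: "\<And>m. m \<in> carrier M \<Longrightarrow> \<exists>w \<in> lists X. word_value M g w = m"
    and eq: "\<And>u v. u \<in> lists X \<Longrightarrow> v \<in> lists X \<Longrightarrow>
      (u, v) \<in> generated_congruence X R \<longleftrightarrow> word_value M g u = word_value M g v"
  shows "has_presentation M g X R"
proof -
  let ?C = "generated_congruence X R"
  let ?P = "presented_monoid X R"
  note E = equiv_generated_congruence[OF R]
  note classes = generated_congruence_lists[OF R]
  define \<phi> where "\<phi> = (\<lambda>A. word_value M g (SOME w. w \<in> A))"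
  have \<phi>: "\<phi> (?C `` {w}) = word_value M g w" if "w \<in> lists X" for w
  proof -
    have "(SOME v. v \<in> ?C `` {w}) \<in> ?C `` {w}"
      by (rule someI[of _ w]) (use that in \<open>auto intro: generated_congruence.reflexive\<close>)
    then have c: "(w, SOME v. v \<in> ?C `` {w}) \<in> ?C" by simp
    then show ?thesis using eq[of w] classes[OF c] unfolding \<phi>_def by metis
  qed
  have car: "carrier ?P = lists X // ?C" by (simp add: presented_monoid_def)
  have cls: "\<exists>w \<in> lists X. A = ?C `` {w}" if "A \<in> carrier ?P" for A
    using that unfolding car quotient_def by blast
  have into: "\<phi> A \<in> carrier M" if A: "A \<in> carrier ?P" for A
  proof -
    obtain w where "w \<in> lists X" "A = ?C `` {w}" using cls[OF A] by blast
    then show ?thesis using \<phi>[of w] word_value_closed[OF M g, of w] by simp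
  qed
  have "\<phi> \<in> hom ?P M"
  proof (rule homI)
    fix A assume "A \<in> carrier ?P"
    then show "\<phi> A \<in> carrier M" by (rule into)
  next
    fix A B assume "A \<in> carrier ?P" "B \<in> carrier ?P"
    then obtain u v where "u \<in> lists X" "v \<in> lists X" "A = ?C `` {u}" "B = ?C `` {v}"
      using cls by blast
    then show "\<phi> (A \<otimes>\<^bsub>?P\<^esub> B) = \<phi> A \<otimes>\<^bsub>M\<^esub> \<phi> B"
      using presented_monoid_mult[OF R, of u v] \<phi>[of "u @ v"] \<phi>[of u] \<phi>[of v]
        word_value_append[OF M g, of u v] by (simp del: in_lists_conv_set)
  qed
  moreover have "inj_on \<phi> (carrier ?P)"
  proof (rule inj_onI)
    fix A B assume "A \<in> carrier ?P" "B \<in> carrier ?P" "\<phi> A = \<phi> B"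
    then obtain u v where "u \<in> lists X" "v \<in> lists X" "A = ?C `` {u}" "B = ?C `` {v}"
      using cls by blast
    then have "(u, v) \<in> ?C" using eq[of u v] \<phi>[of u] \<phi>[of v] \<open>\<phi> A = \<phi> B\<close>
      by (simp del: in_lists_conv_set)
    then show "A = B" using equiv_class_eq[OF E] \<open>A = _\<close> \<open>B = _\<close> by blast
  qed
  moreover have "\<phi> ` carrier ?P = carrier M"
  proof
    show "\<phi> ` carrier ?P \<subseteq> carrier M" using into by blast
    show "carrier M \<subseteq> \<phi> ` carrier ?P"
    proof
      fix m assume "m \<in> carrier M"
      then obtain w where "w \<in> lists X" "word_value M g w = m" using onto by blast
      then show "m \<in> \<phi> ` carrier ?P"
        using \<phi>[of w] by (metis car imageI quotientI)
    qed
  qed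
  ultimately have "\<phi> \<in> iso ?P M" by (simp add: iso_def bij_betw_def)
  moreover have "\<phi> (?C `` {[x]}) = g x" if "x \<in> X" for x
    using that g \<phi>[of "[x]"] by (simp add: monoid.r_one[OF M] image_subset_iff)
  ultimately show ?thesis using M R by (auto simp: has_presentation_def)
qed

text \<open>For an arbitrary presentation the isomorphism sends the class of a word to its value; so the
congruence generated by the relations is equality of values.\<close>

lemma has_presentationD:
  assumes "has_presentation M g X R"
  shows "monoid M" "R \<subseteq> lists X \<times> lists X" "g ` X \<subseteq> carrier M"
    "\<And>m. m \<in> carrier M \<Longrightarrow> \<exists>w \<in> lists X. word_value M g w = m"
    "\<And>u v. u \<in> lists X \<Longrightarrow> v \<in> lists X \<Longrightarrow>
      (u, v) \<in> generated_congruence X R \<longleftrightarrow> word_value M g u = word_value M g v"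
proof -
  let ?C = "generated_congruence X R"
  let ?P = "presented_monoid X R"
  show M: "monoid M" and R: "R \<subseteq> lists X \<times> lists X"
    using assms by (auto simp: has_presentation_def)
  note E = equiv_generated_congruence[OF R]
  obtain \<phi> where \<phi>: "\<phi> \<in> hom ?P M" "inj_on \<phi> (carrier ?P)" "\<phi> ` carrier ?P = carrier M"
    and gen: "\<And>x. x \<in> X \<Longrightarrow> \<phi> (?C `` {[x]}) = g x"
    using assms by (auto simp: has_presentation_def iso_def bij_betw_def)
  have car: "carrier ?P = lists X // ?C" by (simp add: presented_monoid_def)
  have cls: "?C `` {w} \<in> carrier ?P" if "w \<in> lists X" for w
    using that unfolding car quotient_def by blast
  have rep: "\<exists>w \<in> lists X. A = ?C `` {w}" if "A \<in> carrier ?P" for A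
    using that unfolding car quotient_def by blast
  show g: "g ` X \<subseteq> carrier M"
  proof (rule image_subsetI)
    fix x assume "x \<in> X"
    then have "\<phi> (?C `` {[x]}) \<in> carrier M" using \<phi>(3) cls[of "[x]"] by auto
    then show "g x \<in> carrier M" using gen \<open>x \<in> X\<close> by simp
  qed
  have one: "\<phi> (?C `` {[]}) = \<one>\<^bsub>M\<^esub>"
  proof -
    obtain A where A: "A \<in> carrier ?P" "\<phi> A = \<one>\<^bsub>M\<^esub>"
      using \<phi>(3) monoid.one_closed[OF M] by (metis imageE)
    then obtain w where w: "w \<in> lists X" "A = ?C `` {w}" using rep by blast
    have "\<phi> (?C `` {[]} \<otimes>\<^bsub>?P\<^esub> A) = \<phi> (?C `` {[]}) \<otimes>\<^bsub>M\<^esub> \<phi> A"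
      using \<phi>(1) A(1) cls[of "[]"] by (simp add: hom_mult)
    moreover have "?C `` {[]} \<otimes>\<^bsub>?P\<^esub> A = A"
      using presented_monoid_mult[OF R, of "[]" w] w by simp
    moreover have "\<phi> (?C `` {[]}) \<in> carrier M" using \<phi>(3) cls[of "[]"] by auto
    ultimately show ?thesis using A by (simp add: monoid.r_one[OF M])
  qed
  have val: "\<phi> (?C `` {w}) = word_value M g w" if "w \<in> lists X" for w
    using that
  proof (induction rule: lists.induct)
    case Nil
    then show ?case by (simp add: one)
  next
    case (Cons x w)
    have "?C `` {x # w} = ?C `` {[x]} \<otimes>\<^bsub>?P\<^esub> ?C `` {w}"
      using presented_monoid_mult[OF R, of "[x]" w] Cons.hyps by simp
    then have "\<phi> (?C `` {x # w}) = \<phi> (?C `` {[x]}) \<otimes>\<^bsub>M\<^esub> \<phi> (?C `` {w})"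
      using \<phi>(1) cls Cons.hyps by (simp add: hom_mult)
    then show ?case using Cons.IH gen[OF Cons.hyps(1)] by (simp only: word_value_simps)
  qed
  show "\<exists>w \<in> lists X. word_value M g w = m" if "m \<in> carrier M" for m
  proof -
    have "m \<in> \<phi> ` carrier ?P" using that \<phi>(3) by simp
    then obtain A where A: "A \<in> carrier ?P" "m = \<phi> A" by (rule imageE)
    obtain w where w: "w \<in> lists X" "A = ?C `` {w}" using rep[OF A(1)] by (rule bexE)
    show ?thesis by (rule bexI[OF _ w(1)]) (simp only: A(2) w(2) val[OF w(1)])
  qed
  fix u v assume uv: "u \<in> lists X" "v \<in> lists X"
  have "(u, v) \<in> ?C \<longleftrightarrow> ?C `` {u} = ?C `` {v}"
    by (rule eq_equiv_class_iff[OF E uv, symmetric])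
  also have "\<dots> \<longleftrightarrow> \<phi> (?C `` {u}) = \<phi> (?C `` {v})"
    by (rule inj_on_eq_iff[OF \<phi>(2) cls[OF uv(1)] cls[OF uv(2)], symmetric])
  finally show "(u, v) \<in> ?C \<longleftrightarrow> word_value M g u = word_value M g v"
    unfolding val[OF uv(1)] val[OF uv(2)] .
qed

lemma generated_congruence_sound:
  assumes "monoid M" "g ` X \<subseteq> carrier M" "R \<subseteq> lists X \<times> lists X"
    and rel: "\<And>u v. (u, v) \<in> R \<Longrightarrow> word_value M g u = word_value M g v"
    and "(u, v) \<in> generated_congruence X R"
  shows "word_value M g u = word_value M g v"
  using assms(5)
proof (induction rule: generated_congruence.induct)
  case (relation u v)
  then show ?case by (rule rel)
next
  case (compatible u v u' v')
  note lists = generated_congruence_lists[OF assms(3) compatible.hyps(1)]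
    generated_congruence_lists[OF assms(3) compatible.hyps(2)]
  show ?case
    using compatible.IH lists word_value_append[OF assms(1,2), of u u']
      word_value_append[OF assms(1,2), of v v'] by metis
qed simp_all

section \<open>The values of words\<close>

lemma stake_act: "stake n (act q u) = act_fin q (stake n u)"
  by (induction n arbitrary: q u) auto

lemma automaton_semigroup_simps [simp]:
  "\<one>\<^bsub>automaton_semigroup\<^esub> = id" "f \<otimes>\<^bsub>automaton_semigroup\<^esub> h = f \<circ> h"
  by (simp_all add: automaton_semigroup_def)

lemma level_semigroup_simps [simp]:
  "\<one>\<^bsub>level_semigroup n\<^esub> = restrict id (words_of_length n)"
  "f \<otimes>\<^bsub>level_semigroup n\<^esub> h = compose (words_of_length n) f h"
  by (simp_all add: level_semigroup_def)

abbreviation "automaton_value \<equiv> word_value automaton_semigroup act"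

lemma stake_automaton_value: "stake n (automaton_value w u) = apply_word w (stake n u)"
  by (induction w arbitrary: u) (auto simp: automaton_semigroup_def stake_act)

text \<open>Equality of streams is thereby reduced to the finite levels.\<close>

lemma stream_eqI_stake:
  assumes "\<And>n. stake n s = stake n t"
  shows "s = t"
proof -
  have "s !! n = t !! n" for n
    using arg_cong[OF assms[of "Suc n"], of "\<lambda>l. l ! n"] by (simp add: stake_nth del: stake.simps)
  then show ?thesis using smap_alt[of id s t] by (simp add: stream.map_id)
qed

lemma automaton_value_eq_iff_apply_word:
  "automaton_value w = automaton_value v \<longleftrightarrow> (\<forall>u. apply_word w u = apply_word v u)"
proof
  assume eq: "automaton_value w = automaton_value v"
  show "\<forall>u. apply_word w u = apply_word v u"
  proof
    fix u
    have "stake (length u) (u @- sconst X0) = u" by (simp add: stake_shift)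
    then show "apply_word w u = apply_word v u"
      using stake_automaton_value[of "length u" w "u @- sconst X0"]
        stake_automaton_value[of "length u" v "u @- sconst X0"] eq by simp
  qed
next
  assume "\<forall>u. apply_word w u = apply_word v u"
  then show "automaton_value w = automaton_value v"
    by (intro ext stream_eqI_stake) (simp add: stake_automaton_value)
qed

lemma automaton_value_eq_iff:
  "automaton_value w = automaton_value v \<longleftrightarrow> track w = track v"
proof
  assume eq: "automaton_value w = automaton_value v"
  let ?n = "Suc (length (records w))"
  show "track w = track v"
    using eq apply_word_level_eq_iff[of ?n w v] by (auto simp: automaton_value_eq_iff_apply_word)
next
  assume "track w = track v"
  then have "apply_word w u = apply_word v u" for u
    using apply_word_level_eq_iff[of "length u" w v] by simp
  then show "automaton_value w = automaton_value v"
    by (simp add: automaton_value_eq_iff_apply_word)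
qed

lemma automaton_value_append:
  "automaton_value (u @ v) = automaton_value u \<circ> automaton_value v"
  by (induction u) (auto simp: automaton_semigroup_def comp_assoc)

text \<open>The carrier contains nonempty products only, but the value of the empty word is also the value
of \<open>f0 f0\<close>.\<close>

lemma carrier_automaton_semigroup: "carrier automaton_semigroup = range automaton_value"
proof -
  have id: "automaton_value [F0, F0] = id"
    using automaton_value_eq_iff[of "[F0, F0]" "[]"]
    by (simp add: track_def)
  have "f \<in> range automaton_value" if "f \<in> generated_semigroup (\<circ>) (range act)" for f
    using that
  proof induction
    case (generator f)
    then obtain q where "f = act q" by auto
    then have "f = automaton_value [q]" by (simp add: automaton_semigroup_def)
    then show ?case by blast
  next
    case (product f h)
    then obtain u v where "f = automaton_value u" "h = automaton_value v" by blast
    then show ?case using automaton_value_append[of u v] by (intro range_eqI[of _ _ "u @ v"]) simp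
  qed
  moreover have "automaton_value w \<in> generated_semigroup (\<circ>) (range act)" for w
  proof (induction w)
    case Nil
    have "automaton_value [F0, F0] = act F0 \<circ> act F0" by simp
    then have "act F0 \<circ> act F0 = id" using id by simp
    moreover have "act F0 \<circ> act F0 \<in> generated_semigroup (\<circ>) (range act)"
      by (rule generated_semigroup.product; rule generated_semigroup.generator; rule rangeI)
    ultimately show ?case by (simp only: word_value_simps automaton_semigroup_simps)
  next
    case (Cons q w)
    then have "act q \<circ> automaton_value w \<in> generated_semigroup (\<circ>) (range act)"
      by (rule generated_semigroup.product[OF generated_semigroup.generator[OF rangeI]])
    then show ?case by (simp only: word_value_simps automaton_semigroup_simps)
  qed
  ultimately show ?thesis by (auto simp: automaton_semigroup_def)
qed

lemma monoid_automaton_semigroup: "monoid automaton_semigroup"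
proof (rule monoidI)
  show "\<one>\<^bsub>automaton_semigroup\<^esub> \<in> carrier automaton_semigroup"
    unfolding carrier_automaton_semigroup by (rule range_eqI[of _ _ "[]"]) simp
next
  fix x y assume "x \<in> carrier automaton_semigroup" "y \<in> carrier automaton_semigroup"
  then show "x \<otimes>\<^bsub>automaton_semigroup\<^esub> y \<in> carrier automaton_semigroup"
    by (auto simp: automaton_semigroup_def intro: generated_semigroup.product)
qed (auto simp: automaton_semigroup_def comp_assoc)

abbreviation "level_value n \<equiv> word_value (level_semigroup n) (act_level n)"

lemma level_value: "level_value n w = restrict (apply_word w) (words_of_length n)"
proof (induction w)
  case Nil
  then show ?case by (auto simp: level_semigroup_def restrict_def)
next
  case (Cons q w)
  then show ?case
    by (auto simp: level_semigroup_def act_level_def restrict_def compose_def words_of_length_def)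
qed

lemma level_value_eq_iff:
  "level_value n w = level_value n v \<longleftrightarrow> track w = track v \<or>
   (n \<le> length (records w) \<and> n \<le> length (records v) \<and> take n (records w) = take n (records v))"
proof -
  have "level_value n w = level_value n v \<longleftrightarrow>
    (\<forall>u. length u = n \<longrightarrow> apply_word w u = apply_word v u)"
    by (auto simp: level_value words_of_length_def restrict_def fun_eq_iff)
  then show ?thesis by (simp only: apply_word_level_eq_iff)
qed

lemma level_value_append:
  "level_value n (u @ v) = compose (words_of_length n) (level_value n u) (level_value n v)"
  by (auto simp: level_value compose_def restrict_def words_of_length_def)

lemma carrier_level_semigroup: "carrier (level_semigroup n) = range (level_value n)"
proof -
  let ?m = "compose (words_of_length n)"
  have gen: "act_level n q = level_value n [q]" for q
    by (rule ext) (simp add: act_level_def restrict_def compose_def)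
  have "f \<in> range (level_value n)" if "f \<in> generated_semigroup ?m (range (act_level n))" for f
    using that
  proof induction
    case (generator f)
    then obtain q where "f = act_level n q" by blast
    then show ?case using gen[of q] by (intro range_eqI[of _ _ "[q]"]) (rule trans)
  next
    case (product f h)
    then obtain u v where "f = level_value n u" "h = level_value n v" by blast
    then show ?case by (intro range_eqI[of _ _ "u @ v"]) (simp only: level_value_append)
  qed
  moreover have "level_value n w \<in> generated_semigroup ?m (range (act_level n))" for w
  proof (induction w)
    case Nil
    have "level_value n [F0, F0] = level_value n []"
      by (simp only: level_value_eq_iff track_def) simp
    moreover have "?m (act_level n F0) (act_level n F0) \<in> generated_semigroup ?m (range (act_level n))"
      by (rule generated_semigroup.product; rule generated_semigroup.generator; rule rangeI)
    moreover have "level_value n [F0, F0] = ?m (act_level n F0) (act_level n F0)"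
      using level_value_append[of n "[F0]" "[F0]"] unfolding gen[of F0] append.simps .
    ultimately show ?case by (simp only:)
  next
    case (Cons q w)
    then have "?m (act_level n q) (level_value n w) \<in> generated_semigroup ?m (range (act_level n))"
      by (rule generated_semigroup.product[OF generated_semigroup.generator[OF rangeI]])
    then show ?case using level_value_append[of n "[q]" w] unfolding gen[of q] append.simps
      by (simp only:)
  qed
  ultimately show ?thesis by (auto simp: level_semigroup_def)
qed

lemma monoid_level_semigroup: "monoid (level_semigroup n)"
proof (rule monoidI)
  let ?L = "level_semigroup n"
  have mult: "x \<otimes>\<^bsub>?L\<^esub> y = compose (words_of_length n) x y" for x y
    by (simp add: level_semigroup_def)
  show "\<one>\<^bsub>?L\<^esub> \<in> carrier ?L"
    unfolding carrier_level_semigroup by (rule range_eqI[of _ _ "[]"]) simp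
  fix x assume "x \<in> carrier ?L"
  then obtain u where u: "x = level_value n u" by (auto simp: carrier_level_semigroup)
  show "\<one>\<^bsub>?L\<^esub> \<otimes>\<^bsub>?L\<^esub> x = x"
    using level_value_append[of n "[]" u] by (simp add: u mult)
  show "x \<otimes>\<^bsub>?L\<^esub> \<one>\<^bsub>?L\<^esub> = x"
    using level_value_append[of n u "[]"] by (simp add: u mult)
  fix y assume "y \<in> carrier ?L"
  then obtain v where v: "y = level_value n v" by (auto simp: carrier_level_semigroup)
  show "x \<otimes>\<^bsub>?L\<^esub> y \<in> carrier ?L"
    by (simp add: u v mult carrier_level_semigroup flip: level_value_append)
  fix z assume "z \<in> carrier ?L"
  then obtain w where w: "z = level_value n w" by (auto simp: carrier_level_semigroup)
  show "x \<otimes>\<^bsub>?L\<^esub> y \<otimes>\<^bsub>?L\<^esub> z = x \<otimes>\<^bsub>?L\<^esub> (y \<otimes>\<^bsub>?L\<^esub> z)"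
    by (simp add: u v w mult flip: level_value_append)
qed

section \<open>Normal forms and the presentations\<close>

primrec spell :: "letter \<Rightarrow> state list" where
  "spell X0 = [F0, F1]"
| "spell X1 = [F1, F0]"

definition spell_word :: "letter list \<Rightarrow> state list" where
  "spell_word r = concat (map spell r)"

lemma spell_word_simps [simp]:
  "spell_word [] = []"
  "spell_word (x # r) = spell x @ spell_word r"
  "spell_word (r @ s) = spell_word r @ spell_word s"
  by (simp_all add: spell_word_def)

lemma spell_word_replicate: "spell_word (replicate p x) = word_power (spell x) p"
  by (induction p) auto

definition relator :: "nat \<Rightarrow> state list \<times> state list" where
  "relator p =
    ([F1] @ word_power [F0, F1] p @ word_power [F1, F0] p @ [F1, F1],
     [F1] @ word_power [F0, F1] p @ word_power [F1, F0] p)"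

lemma relator_spell:
  "relator p =
    ([F1] @ spell_word (replicate p X0) @ spell_word (replicate p X1) @ [F1, F1],
     [F1] @ spell_word (replicate p X0) @ spell_word (replicate p X1))"
  by (simp add: relator_def spell_word_replicate)

text \<open>A standard walk with a given sequence of records. The sequence is given last record first. If the
new record is in the direction of the previous one, one more step suffices; otherwise the walk has to
cross the whole interval, of length \<open>length r\<close>, and then leave it.\<close>

primrec sweep :: "letter list \<Rightarrow> letter list" where
  "sweep [] = []"
| "sweep (x # r) =
    sweep r @ (if r = [] \<or> hd r = x then [x] else replicate (Suc (length r)) x)"

definition normal_letters :: "history \<Rightarrow> letter list" where
  "normal_letters = (\<lambda>(r, d). sweep (rev r) @
     (if r = [] then [] else replicate (d (last r)) (opposite (last r))))"

definition normal_word :: "history \<times> bool \<Rightarrow> state list" where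
  "normal_word = (\<lambda>(h, e). spell_word (normal_letters h) @ (if e then [F0] else []))"

text \<open>The last record was preceded by a crossing of the whole interval. This is the run that the relations
need in order to undo later steps in the other direction.\<close>

lemma sweep_ends:
  assumes "r \<noteq> []"
  shows "\<exists>v. sweep r = v @ replicate (length r) (hd r)"
  using assms
proof (induction r)
  case (Cons x r)
  show ?case
  proof (cases "r = [] \<or> hd r \<noteq> x")
    case True
    then show ?thesis by auto
  next
    case False
    then obtain v where "sweep r = v @ replicate (length r) x" using Cons.IH by auto
    then show ?thesis using False by (auto simp: replicate_append_same)
  qed
qed simp

lemma normal_letters_record:
  assumes "total d = length r" "d x = 0"
  shows "normal_letters (walk x (r, d)) = normal_letters (r, d) @ [x]"
proof (cases "r = [] \<or> last r = x")
  case True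
  then show ?thesis using assms
    by (auto simp: normal_letters_def hd_rev inc_dec_opposite)
next
  case False
  then have last: "last r = opposite x" by (simp add: neq_iff_opposite)
  have "d (opposite x) = length r" using assms by (simp add: total_eq[of d x])
  then show ?thesis using assms False last
    by (auto simp: normal_letters_def hd_rev inc_dec_opposite replicate_append_same)
qed

text \<open>A congruence on words in the generators in which \<open>f0\<close> is an involution. Further relations
are assumed only where they are used, since the presentations of \<open>S\<close> and of \<open>S\<^sub>n\<close> share these arguments.\<close>

locale word_congruence =
  fixes eqv :: "state list \<Rightarrow> state list \<Rightarrow> bool" (infix "\<approx>" 50)
  assumes eqv_refl [simp]: "u \<approx> u"
    and eqv_sym: "u \<approx> v \<Longrightarrow> v \<approx> u"
    and eqv_trans [trans]: "u \<approx> v \<Longrightarrow> v \<approx> w \<Longrightarrow> u \<approx> w"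
    and eqv_append: "u \<approx> v \<Longrightarrow> u' \<approx> v' \<Longrightarrow> u @ u' \<approx> v @ v'"
    and involution: "[F0, F0] \<approx> []"
begin

lemma eqv_left: "u \<approx> v \<Longrightarrow> a @ u \<approx> a @ v"
  by (intro eqv_append) auto

lemma eqv_right: "u \<approx> v \<Longrightarrow> u @ b \<approx> v @ b"
  by (intro eqv_append) auto

lemma cancel_left: "F0 # F0 # u \<approx> u"
  using eqv_right[OF involution, of u] by simp

lemma cancel_right: "u @ [F0, F0] \<approx> u"
  using eqv_left[OF involution, of u] by simp

lemma F1_spell_X1: "[F1] \<approx> spell X1 @ [F0]"
  using eqv_sym[OF cancel_right[of "[F1]"]] by simp

lemma F1_spell_X0: "[F1] \<approx> [F0] @ spell X0"
  using eqv_sym[OF cancel_left[of "[F1]"]] by simp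

lemma F1_F1: "[F1, F1] \<approx> spell X1 @ spell X0"
  using eqv_append[OF eqv_refl[of "[F1]"] F1_spell_X0] by simp

lemma flip_spell: "[F0] @ spell x \<approx> spell (opposite x) @ [F0]"
proof (cases x)
  case X0
  then show ?thesis using eqv_trans[OF eqv_sym[OF F1_spell_X0] F1_spell_X1] by simp
qed simp

text \<open>Conjugation by \<open>f0\<close> exchanges the two directions, as \<open>f0 (f0 f1) f0 = f1 f0\<close>.\<close>

lemma flip_spell_word: "[F0] @ spell_word r \<approx> spell_word (map opposite r) @ [F0]"
proof (induction r)
  case (Cons x r)
  have "[F0] @ spell_word (x # r) \<approx> spell (opposite x) @ [F0] @ spell_word r"
    using eqv_right[OF flip_spell[of x], of "spell_word r"] by simp
  also have "\<dots> \<approx> spell (opposite x) @ spell_word (map opposite r) @ [F0]"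
    by (rule eqv_left[OF Cons.IH])
  finally show ?case by simp
qed simp

lemma conjugate_spell_word: "[F0] @ spell_word r @ [F0] \<approx> spell_word (map opposite r)"
proof -
  have "[F0] @ spell_word r @ [F0] \<approx> spell_word (map opposite r) @ [F0, F0]"
    using eqv_right[OF flip_spell_word[of r], of "[F0]"] by simp
  also have "\<dots> \<approx> spell_word (map opposite r)" by (rule cancel_right)
  finally show ?thesis .
qed

text \<open>The relation, rewritten in steps: a step back undoes the last of \<open>p + 1\<close> steps, if these were preceded by
\<open>p + 1\<close> steps in the other direction. One of the two directions is the given relation, the other one
its conjugate by \<open>f0\<close>.\<close>

lemma turn_relation:
  assumes "fst (relator p) \<approx> snd (relator p)"
  shows "spell_word (replicate (Suc p) x @ replicate (Suc p) (opposite x) @ [x])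
    \<approx> spell_word (replicate (Suc p) x @ replicate p (opposite x))"
proof -
  let ?b = "\<lambda>p. spell_word (replicate p X0)" and ?c = "\<lambda>p. spell_word (replicate p X1)"
  let ?l = "replicate (Suc p) X0 @ replicate (Suc p) X1 @ [X0]"
  let ?r = "replicate (Suc p) X0 @ replicate p X1"
  have c: "?c p @ spell X1 = ?c (Suc p)"
    using spell_word_simps(3)[of "replicate p X1" "[X1]"] by (simp add: replicate_append_same)
  have "[F0] @ spell_word ?l = ([F0] @ spell X0) @ ?b p @ ?c p @ spell X1 @ spell X0"
    using c by simp
  also have "\<dots> \<approx> [F1] @ ?b p @ ?c p @ spell X1 @ spell X0"
    by (rule eqv_right[OF eqv_sym[OF F1_spell_X0]])
  also have "\<dots> \<approx> [F1] @ ?b p @ ?c p @ [F1, F1]"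
    by (intro eqv_left eqv_sym[OF F1_F1])
  also have "\<dots> \<approx> [F1] @ ?b p @ ?c p" using assms by (simp add: relator_spell)
  also have "\<dots> \<approx> ([F0] @ spell X0) @ ?b p @ ?c p" by (rule eqv_right[OF F1_spell_X0])
  also have "\<dots> = [F0] @ spell_word ?r" by simp
  finally have *: "[F0] @ spell_word ?l \<approx> [F0] @ spell_word ?r" .
  show ?thesis
  proof (cases x)
    case X0
    have "spell_word ?l \<approx> [F0] @ [F0] @ spell_word ?l"
      using eqv_sym[OF cancel_left] by simp
    also have "\<dots> \<approx> [F0] @ [F0] @ spell_word ?r" by (rule eqv_left[OF *])
    also have "\<dots> \<approx> spell_word ?r" using cancel_left by simp
    finally show ?thesis using X0 by simp
  next
    case X1
    have "spell_word (map opposite ?l) \<approx> [F0] @ spell_word ?l @ [F0]"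
      by (rule eqv_sym[OF conjugate_spell_word])
    also have "\<dots> \<approx> [F0] @ spell_word ?r @ [F0]" using eqv_right[OF *, of "[F0]"] by simp
    also have "\<dots> \<approx> spell_word (map opposite ?r)" by (rule conjugate_spell_word)
    finally show ?thesis using X1 by simp
  qed
qed

text \<open>Only a step towards the last record needs a relation: a record or a step away from the last record extends
the standard walk by definition.\<close>

lemma normal_letters_walk:
  assumes tot: "total d = length r"
    and rel: "\<And>p. p < length r \<Longrightarrow> fst (relator p) \<approx> snd (relator p)"
  shows "spell_word (normal_letters (r, d) @ [x]) \<approx> spell_word (normal_letters (walk x (r, d)))"
proof (cases "d x = 0")
  case True
  then show ?thesis by (simp only: normal_letters_record[OF tot] eqv_refl)
next
  case False
  then have r: "r \<noteq> []" using tot by (auto simp: total_eq[of d x])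
  show ?thesis
  proof (cases "last r = x")
    case neq: False
    then have last: "last r = opposite x" by (simp add: neq_iff_opposite)
    have "normal_letters (walk x (r, d)) = normal_letters (r, d) @ [x]"
      using False r last by (simp add: normal_letters_def inc_dec_opposite replicate_append_same)
    then show ?thesis by (simp only: eqv_refl)
  next
    case last: True
    obtain k where k: "d x = Suc k" using False by (cases "d x") auto
    have kr: "Suc k \<le> length r" using tot k by (simp add: total_eq[of d x])
    obtain v where "sweep (rev r) = v @ replicate (length r) x"
      using sweep_ends[of "rev r"] r last by (auto simp: hd_rev)
    then have v: "sweep (rev r) = (v @ replicate (length r - Suc k) x) @ replicate (Suc k) x"
      using replicate_add[of "length r - Suc k" "Suc k" x] le_add_diff_inverse2[OF kr]
      by (simp only: append_assoc)
    let ?v = "spell_word (v @ replicate (length r - Suc k) x)"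
    have before: "normal_letters (r, d) = sweep (rev r) @ replicate (Suc k) (opposite x)"
      using r last k by (simp add: normal_letters_def)
    have after: "normal_letters (walk x (r, d)) = sweep (rev r) @ replicate k (opposite x)"
      using r last k by (simp add: normal_letters_def inc_dec_opposite)
    have "spell_word (normal_letters (r, d) @ [x]) =
      ?v @ spell_word (replicate (Suc k) x @ replicate (Suc k) (opposite x) @ [x])"
      by (simp only: before v append_assoc spell_word_simps)
    also have "\<dots> \<approx> ?v @ spell_word (replicate (Suc k) x @ replicate k (opposite x))"
      using kr by (intro eqv_left turn_relation rel) simp
    also have "\<dots> = spell_word (normal_letters (walk x (r, d)))"
      by (simp only: after v append_assoc spell_word_simps)
    finally show ?thesis .
  qed
qed

lemma append_F1:
  "(spell_word l @ (if e then [F0] else [])) @ [F1] \<approx>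
   spell_word (l @ [if e then X0 else X1]) @ (if \<not> e then [F0] else [])"
  using eqv_left[OF F1_spell_X1, of "spell_word l"] by simp

text \<open>Only relations with \<open>p\<close> below the number of records are used. This is what makes the argument available for \<open>S\<^sub>n\<close>.\<close>

lemma eqv_normal_word:
  assumes "\<And>p. p < length (records w) \<Longrightarrow> fst (relator p) \<approx> snd (relator p)"
  shows "w \<approx> normal_word (track w)"
  using assms
proof (induction w rule: rev_induct)
  case Nil
  then show ?case by (simp add: normal_word_def normal_letters_def)
next
  case (snoc q w)
  obtain r d e where w: "track w = ((r, d), e)" by (rule track_cases)
  have tot: "total d = length r" using total_track[of w] w by (simp add: records_def)
  have len: "length r \<le> length (records (w @ [q]))"
    using w by (cases q) (auto simp: records_def)
  have rel: "fst (relator p) \<approx> snd (relator p)" if "p < length r" for p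
    using snoc.prems[of p] that len by simp
  have "w \<approx> normal_word (track w)"
    using snoc.IH rel w by (simp add: records_def)
  then have "w @ [q] \<approx> normal_word (track w) @ [q]" by (rule eqv_right)
  also have "\<dots> \<approx> normal_word (track (w @ [q]))"
  proof (cases q)
    case F0
    show ?thesis
      using w cancel_right[of "spell_word (normal_letters (r, d))"]
      unfolding track_snoc w F0 normal_word_def by (cases e) simp_all
  next
    case F1
    let ?x = "if e then X0 else X1"
    have "normal_word (track w) @ [q] =
      (spell_word (normal_letters (r, d)) @ (if e then [F0] else [])) @ [F1]"
      unfolding w F1 normal_word_def by simp
    also have "\<dots> \<approx> spell_word (normal_letters (r, d) @ [?x]) @ (if \<not> e then [F0] else [])"
      by (rule append_F1)
    also have "\<dots> \<approx> spell_word (normal_letters (walk ?x (r, d))) @ (if \<not> e then [F0] else [])"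
      by (intro eqv_right normal_letters_walk tot rel)
    also have "\<dots> = normal_word (track (w @ [q]))"
      unfolding track_snoc w F1 normal_word_def by simp
    finally show ?thesis .
  qed
  finally show ?case .
qed

text \<open>The relations give the claim for \<open>X0\<close> directly. For \<open>X1\<close> it follows because conjugation by \<open>f0\<close>
and absorption of the final \<open>f0\<close> identify \<open>c\<^sup>n\<close> with \<open>f1 b\<^sup>n\<^sup>-\<^sup>1\<close>.\<close>

lemma absorb:
  assumes n: "n \<ge> 1"
    and zero: "\<And>q. [F1] @ word_power [F0, F1] (n - 1) @ [q] \<approx> [F1] @ word_power [F0, F1] (n - 1)"
  shows "spell_word (replicate n x) @ [q] \<approx> spell_word (replicate n x)"
proof -
  obtain m where m: "n = Suc m" using n by (cases n) auto
  define z where "z = [F1] @ word_power [F0, F1] m"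
  have z: "z @ [q] \<approx> z" for q using zero[of q] by (simp add: z_def m)
  have b: "spell_word (replicate n X0) = [F0] @ z"
    using spell_word_replicate[of n X0] by (simp add: m z_def)
  have c: "spell_word (replicate n X1) \<approx> z"
  proof -
    have "spell_word (replicate n X1) \<approx> [F0] @ spell_word (replicate n X0) @ [F0]"
      using eqv_sym[OF conjugate_spell_word[of "replicate n X0"]] by simp
    also have "\<dots> \<approx> z @ [F0]" unfolding b using cancel_left[of "z @ [F0]"] by simp
    also have "\<dots> \<approx> z" by (rule z)
    finally show ?thesis .
  qed
  show ?thesis
  proof (cases x)
    case X0
    then show ?thesis using eqv_left[OF z[of q], of "[F0]"] b by simp
  next
    case X1
    have "spell_word (replicate n X1) @ [q] \<approx> z @ [q]" by (rule eqv_right[OF c])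
    also have "\<dots> \<approx> z" by (rule z)
    also have "\<dots> \<approx> spell_word (replicate n X1)" by (rule eqv_sym[OF c])
    finally show ?thesis using X1 by simp
  qed
qed

text \<open>At the moment of the \<open>n\<close>-th record the word is congruent to a standard walk that ends in a run
of length \<open>n\<close>; this run absorbs all later letters, including the parity.\<close>

lemma eqv_sweep:
  assumes n: "n \<ge> 1"
    and zero: "\<And>q. [F1] @ word_power [F0, F1] (n - 1) @ [q] \<approx> [F1] @ word_power [F0, F1] (n - 1)"
    and rel: "\<And>p. p + 2 \<le> n \<Longrightarrow> fst (relator p) \<approx> snd (relator p)"
    and "n \<le> length (records w)"
  shows "w \<approx> spell_word (sweep (rev (take n (records w))))"
  using assms(4)
proof (induction w rule: rev_induct)
  case Nil
  then show ?case using n by (simp add: records_def)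
next
  case (snoc q w)
  obtain r d e where w: "track w = ((r, d), e)" by (rule track_cases)
  have tot: "total d = length r" using total_track[of w] w by (simp add: records_def)
  have absorb': "spell_word (sweep (rev s)) @ [q] \<approx> spell_word (sweep (rev s))"
    if s: "length s = n" for s q
  proof -
    have "rev s \<noteq> []" using s n by auto
    from sweep_ends[OF this] obtain v where "sweep (rev s) = v @ replicate n (hd (rev s))"
      unfolding length_rev s by blast
    then show ?thesis using eqv_left[OF absorb[OF n zero]] by simp
  qed
  show ?case
  proof (cases "n \<le> length r")
    case True
    have "take n (records (w @ [q])) = take n r" using w True by (cases q) (auto simp: records_def)
    moreover have "w \<approx> spell_word (sweep (rev (take n r)))"
      using snoc.IH w True by (simp add: records_def)
    moreover have "spell_word (sweep (rev (take n r))) @ [q] \<approx> spell_word (sweep (rev (take n r)))"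
      using True by (intro absorb') simp
    ultimately show ?thesis using eqv_trans[OF eqv_right] by metis
  next
    case False
    let ?x = "if e then X0 else X1"
    have q: "q = F1" and rec: "d ?x = 0" and len: "Suc (length r) = n"
      using snoc.prems w False by (cases q; auto simp: records_def split: if_splits)+
    have w': "records (w @ [q]) = r @ [?x]" using w q rec by (simp add: records_def)
    have "w @ [q] \<approx> (spell_word (normal_letters (r, d)) @ (if e then [F0] else [])) @ [F1]"
    proof -
      have "fst (relator p) \<approx> snd (relator p)" if "p < length (records w)" for p
        using that w len by (intro rel) (simp add: records_def)
      then have "w \<approx> normal_word (track w)" by (rule eqv_normal_word)
      then show ?thesis unfolding w q normal_word_def by (intro eqv_right) simp
    qed
    also have "\<dots> \<approx> spell_word (normal_letters (r, d) @ [?x]) @ (if \<not> e then [F0] else [])"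
      by (rule append_F1)
    also have "\<dots> = spell_word (sweep (rev (r @ [?x]))) @ (if \<not> e then [F0] else [])"
    proof -
      have "normal_letters (r, d) @ [?x] = normal_letters (walk ?x (r, d))"
        by (rule normal_letters_record[OF tot rec, symmetric])
      also have "\<dots> = sweep (rev (r @ [?x]))"
        using rec by (simp add: normal_letters_def inc_dec_opposite)
      finally show ?thesis by simp
    qed
    also have "\<dots> \<approx> spell_word (sweep (rev (r @ [?x])))"
      using absorb'[of "r @ [?x]" F0] len by (cases e) simp_all
    finally show ?thesis using w' len by simp
  qed
qed

end

lemma generated_congruence_interpretation:
  fixes R :: "(state list \<times> state list) set"
  assumes "([F0, F0], []) \<in> R"
  shows "word_congruence (\<lambda>u v. (u, v) \<in> generated_congruence UNIV R)"
proof
  show "(u, u) \<in> generated_congruence UNIV R" for u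
    by (rule generated_congruence.reflexive) simp
qed (use assms in \<open>auto intro: generated_congruence.intros\<close>)

lemma word_power_snoc: "word_power w (Suc p) = word_power w p @ w"
  by (induction p) auto

lemma track_snoc2: "track (w @ [q, q']) = track_step (track_step (track w) q) q'"
  using track_snoc[of "w @ [q]" q'] by simp

lemma track_up:
  "track ([F1] @ word_power [F0, F1] p) =
    ((replicate (Suc p) X1, \<lambda>x. if x = X0 then Suc p else 0), True)"
proof (induction p)
  case 0
  show ?case by (auto simp: track_def dec_apply inc_apply letter_fun_eq_iff)
next
  case (Suc p)
  have "track ([F1] @ word_power [F0, F1] (Suc p)) =
    track_step (track_step (track ([F1] @ word_power [F0, F1] p)) F0) F1"
    using track_snoc2[of "[F1] @ word_power [F0, F1] p" F0 F1]
    by (simp only: word_power_snoc append_assoc)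
  then show ?case unfolding Suc.IH
    by (auto simp: dec_apply inc_apply letter_fun_eq_iff replicate_append_same)
qed

lemma track_up_down:
  assumes "p \<le> n"
  shows "track ([F1] @ word_power [F0, F1] n @ word_power [F1, F0] p) =
    ((replicate (Suc n) X1, \<lambda>x. if x = X0 then Suc n - p else p), True)"
  using assms
proof (induction p)
  case 0
  show ?case using track_up[of n] by (auto simp: letter_fun_eq_iff)
next
  case (Suc p)
  have "track ([F1] @ word_power [F0, F1] n @ word_power [F1, F0] (Suc p)) =
    track_step (track_step (track ([F1] @ word_power [F0, F1] n @ word_power [F1, F0] p)) F1) F0"
    using track_snoc2[of "[F1] @ word_power [F0, F1] n @ word_power [F1, F0] p" F1 F0]
    by (simp only: word_power_snoc append_assoc)
  also have "\<dots> = ((replicate (Suc n) X1, \<lambda>x. if x = X0 then Suc n - Suc p else Suc p), True)"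
    using Suc.prems unfolding Suc.IH[OF Suc_leD[OF Suc.prems]]
    by (auto simp: dec_apply inc_apply letter_fun_eq_iff)
  finally show ?case .
qed

text \<open>The walk goes up \<open>p + 1\<close> steps and down \<open>p\<close>; the final \<open>f1 f1\<close> is one more step down, still inside the
visited interval, and back up.\<close>

lemma track_relator: "track (fst (relator p)) = track (snd (relator p))"
proof -
  have "track (fst (relator p)) =
    track_step (track_step (track ([F1] @ word_power [F0, F1] p @ word_power [F1, F0] p)) F1) F1"
    using track_snoc2[of "[F1] @ word_power [F0, F1] p @ word_power [F1, F0] p" F1 F1]
    by (simp only: relator_def fst_conv append_assoc)
  also have "\<dots> = track (snd (relator p))"
    unfolding relator_def snd_conv track_up_down[OF order_refl]
    by (auto simp: dec_apply inc_apply letter_fun_eq_iff)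
  finally show ?thesis .
qed

lemma track_eq_of_relation:
  assumes "(u, v) \<in> {([F0, F0], [])} \<union> range relator"
  shows "track u = track v"
proof (cases "(u, v) = ([F0, F0], [])")
  case True
  then show ?thesis by (simp add: track_def)
next
  case False
  then obtain p where "(u, v) = relator p" using assms by auto
  then show ?thesis using track_relator[of p] by (metis fst_conv snd_conv)
qed

lemma presentation_automaton_semigroup:
  "has_presentation automaton_semigroup act UNIV ({([F0, F0], [])} \<union> range relator)"
proof (rule has_presentationI)
  let ?R = "{([F0, F0], [])} \<union> range relator"
  show "monoid automaton_semigroup" by (rule monoid_automaton_semigroup)
  show lists: "?R \<subseteq> lists UNIV \<times> lists UNIV" by auto
  show gen: "act ` UNIV \<subseteq> carrier automaton_semigroup"
    by (auto simp: automaton_semigroup_def intro: generated_semigroup.generator)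
  show "\<exists>w \<in> lists UNIV. automaton_value w = m" if "m \<in> carrier automaton_semigroup" for m
    using that by (auto simp: carrier_automaton_semigroup)
  show "(u, v) \<in> generated_congruence UNIV ?R \<longleftrightarrow> automaton_value u = automaton_value v" for u v
  proof
    assume "(u, v) \<in> generated_congruence UNIV ?R"
    then show "automaton_value u = automaton_value v"
    proof (rule generated_congruence_sound[OF monoid_automaton_semigroup gen lists, rotated])
      fix u v assume "(u, v) \<in> ?R"
      then have "track u = track v" by (rule track_eq_of_relation)
      then show "automaton_value u = automaton_value v" by (simp only: automaton_value_eq_iff)
    qed
  next
    assume "automaton_value u = automaton_value v"
    then have track: "track u = track v" by (simp only: automaton_value_eq_iff)
    interpret word_congruence "\<lambda>u v. (u, v) \<in> generated_congruence UNIV ?R"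
      by (rule generated_congruence_interpretation) simp
    have "(w, normal_word (track w)) \<in> generated_congruence UNIV ?R" for w
      by (rule eqv_normal_word, rule generated_congruence.relation) simp
    from this[of u] this[of v] show "(u, v) \<in> generated_congruence UNIV ?R"
      unfolding track using eqv_sym eqv_trans by blast
  qed
qed

lemma presentation_level_semigroup:
  assumes n: "n \<ge> 1"
  defines "z \<equiv> [F1] @ word_power [F0, F1] (n - 1)"
  shows "has_presentation (level_semigroup n) (act_level n) UNIV
    ({([F0, F0], [])} \<union> relator ` {p. p + 2 \<le> n} \<union> {(z @ [F1], z), (z @ [F0], z)})"
proof (rule has_presentationI)
  let ?R = "{([F0, F0], [])} \<union> relator ` {p. p + 2 \<le> n} \<union> {(z @ [F1], z), (z @ [F0], z)}"
  let ?C = "generated_congruence UNIV ?R"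
  show "monoid (level_semigroup n)" by (rule monoid_level_semigroup)
  show lists: "?R \<subseteq> lists UNIV \<times> lists UNIV" by auto
  show gen: "act_level n ` UNIV \<subseteq> carrier (level_semigroup n)"
    by (auto simp: level_semigroup_def intro: generated_semigroup.generator)
  show "\<exists>w \<in> lists UNIV. level_value n w = m" if "m \<in> carrier (level_semigroup n)" for m
    using that by (auto simp: carrier_level_semigroup)
  show "(u, v) \<in> ?C \<longleftrightarrow> level_value n u = level_value n v" for u v
  proof
    assume "(u, v) \<in> ?C"
    then show "level_value n u = level_value n v"
    proof (rule generated_congruence_sound[OF monoid_level_semigroup gen lists, rotated])
      have z: "records z = replicate n X1"
        using track_up[of "n - 1"] n by (simp add: z_def records_def)
      have zq: "records (z @ [q]) = replicate n X1 \<or> records (z @ [q]) = replicate n X1 @ [X0] \<or>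
         records (z @ [q]) = replicate n X1 @ [X1]" for q
        using track_up[of "n - 1"] n unfolding records_def track_snoc z_def
        by (cases q) (auto)
      have *: "level_value n (z @ [q]) = level_value n z" for q
        using zq[of q] z unfolding level_value_eq_iff by auto
      fix u v assume "(u, v) \<in> ?R"
      then consider "track u = track v" | q where "u = z @ [q]" "v = z"
        using track_eq_of_relation by blast
      then show "level_value n u = level_value n v"
      proof cases
        case 1
        then show ?thesis by (simp only: level_value_eq_iff simp_thms)
      next
        case 2
        then show ?thesis using * by (simp only:)
      qed
    qed
  next
    assume eq: "level_value n u = level_value n v"
    interpret word_congruence "\<lambda>u v. (u, v) \<in> ?C"
      by (rule generated_congruence_interpretation) simp
    have rel: "(fst (relator p), snd (relator p)) \<in> ?C" if "p + 2 \<le> n" for p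
      by (rule generated_congruence.relation) (use that in simp)
    show "(u, v) \<in> ?C"
    proof (cases "track u = track v \<and> length (records u) < n")
      case True
      have "(w, normal_word (track w)) \<in> ?C" if "length (records w) < n" for w
        using that by (intro eqv_normal_word rel) simp
      from this[of u] this[of v] True show ?thesis
        unfolding records_def using eqv_sym eqv_trans by metis
    next
      case False
      then have *: "n \<le> length (records u)" "n \<le> length (records v)"
        "take n (records u) = take n (records v)"
        using eq unfolding level_value_eq_iff by (auto simp: records_def)
      have zero: "([F1] @ word_power [F0, F1] (n - 1) @ [q], [F1] @ word_power [F0, F1] (n - 1)) \<in> ?C" for q
        by (rule generated_congruence.relation) (cases q; simp add: z_def)
      have "(w, spell_word (sweep (rev (take n (records w))))) \<in> ?C" if "n \<le> length (records w)" for w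
        using eqv_sweep[OF n zero rel that] .
      from this[OF *(1)] this[OF *(2)] *(3) show ?thesis
        using eqv_sym eqv_trans by metis
    qed
  qed
qed

section \<open>No finite presentation\<close>

text \<open>The number of times that \<open>f1\<close> is applied to a word without \<open>X1\<close>. Equivalently, \<open>f1\<close> acts on pairs of
a word of fixed length and a natural number, and adds \<open>1\<close> to the number whenever it is still in state
\<open>F1\<close> at the end of the word.\<close>

primrec overflows :: "state list \<Rightarrow> letter list \<Rightarrow> nat" where
  "overflows [] u = 0"
| "overflows (q # w) u =
    (if q = F1 \<and> X1 \<notin> set (apply_word w u) then 1 else 0) + overflows w u"

lemma overflows_append:
  "overflows (w @ v) u = overflows w (apply_word v u) + overflows v u"
  by (induction w) auto

text \<open>The number of deletions that find no letter.\<close>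

definition missing :: "(letter \<Rightarrow> nat) \<Rightarrow> letter list \<Rightarrow> nat" where
  "missing d u = (d X0 - count_list u X0) + (d X1 - count_list u X1)"

lemma missing_eq:
  "missing d u = (d x - count_list u x) + (d (opposite x) - count_list u (opposite x))"
  by (cases x) (auto simp: missing_def)

lemma count_list_fill:
  "count_list (fill x u) x = count_list u x + (if opposite x \<in> set u then 1 else 0)"
  "count_list (fill x u) (opposite x) = count_list u (opposite x) - 1"
  by (induction u) (auto simp: neq_iff_opposite)

lemma count_list_total: "count_list u x + count_list u (opposite x) = length u"
  by (induction u) (auto simp: neq_iff_opposite)

text \<open>The overflow of a step is one more deletion without a letter to delete. Beyond \<open>length u\<close> records the two sides
may differ.\<close>

lemma missing_fill:
  assumes "total d \<le> length u"
  shows "missing d (fill x u) + (if opposite x \<in> set u then 0 else 1) =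
    missing (inc (opposite x) (dec x 1 d)) u"
proof -
  let ?d = "inc (opposite x) (dec x 1 d)"
  have d: "?d x = d x - 1" "?d (opposite x) = Suc (d (opposite x))"
    by simp_all
  have le: "d x \<le> length u" using assms by (simp add: total_eq[of d x])
  show ?thesis
  proof (cases "opposite x \<in> set u")
    case True
    then have "count_list u (opposite x) \<noteq> 0" by (simp add: count_list_0_iff)
    then show ?thesis unfolding missing_eq[of _ _ x] d count_list_fill using True by simp
  next
    case False
    then have "count_list u (opposite x) = 0" by (simp add: count_list_0_iff)
    then show ?thesis unfolding missing_eq[of _ _ x] d count_list_fill
      using False le count_list_total[of u x] by simp
  qed
qed

text \<open>While the number of records does not exceed the level, the number of overflows depends on the
history and the parity alone.\<close>

lemma overflows_track:
  assumes "track w = ((r, d), e)" "length r \<le> length u"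
  shows "overflows w u = missing d (flip e u)"
  using assms
proof (induction w arbitrary: u r d e rule: rev_induct)
  case Nil
  then show ?case by (auto simp: missing_def)
next
  case (snoc q w)
  obtain r' d' e' where w: "track w = ((r', d'), e')" by (rule track_cases)
  have tot: "total d' = length r'"
    using total_track[of w] w by (simp add: records_def)
  have len: "length r' \<le> length u"
    using snoc.prems w by (cases q) (auto split: if_splits)
  have IH: "overflows (w @ [q]) u =
      missing d' (flip e' (act_fin q u)) + (if q = F1 \<and> X1 \<notin> set u then 1 else 0)"
    using snoc.IH[OF w, of "act_fin q u"] len by (simp add: overflows_append)
  show ?case
  proof (cases q)
    case F0
    have "flip e' (act_fin F0 u) = flip (\<not> e') u"
      by (auto simp: flip_def act_fin_F0)
    then show ?thesis using IH snoc.prems w F0 by auto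
  next
    case F1
    let ?x = "if e' then X0 else X1"
    have f: "flip e' (act_fin F1 u) = fill ?x (flip (\<not> e') u)"
      by (auto simp: flip_def act_fin_F1 map_opposite_fill)
    have "opposite ?x \<in> set (flip (\<not> e') u) \<longleftrightarrow> X1 \<in> set u"
      by (auto simp: flip_def image_iff) (metis opposite_opposite opposite.simps)+
    then show ?thesis
      using missing_fill[of d' "flip (\<not> e') u" ?x] tot len IH snoc.prems w F1 f by auto
  qed
qed

definition truncated_congruence :: "nat \<Rightarrow> (state list \<times> state list) set" where
  "truncated_congruence n =
    generated_congruence UNIV ({([F0, F0], [])} \<union> relator ` {..<n})"

lemma truncated_congruence_sound:
  assumes "(u, v) \<in> truncated_congruence n" "length s = n"
  shows "apply_word u s = apply_word v s \<and> overflows u s = overflows v s"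
  using assms unfolding truncated_congruence_def
proof (induction arbitrary: s rule: generated_congruence.induct)
  case (relation u v)
  then have track: "track u = track v" by (intro track_eq_of_relation) auto
  obtain r d e where u: "track u = ((r, d), e)" by (rule track_cases)
  have "length r \<le> n"
  proof (cases "(u, v) = ([F0, F0], [])")
    case True
    then show ?thesis using u by (auto simp: track_def)
  next
    case False
    then obtain p where "p < n" "(u, v) = relator p" using relation by auto
    then have p: "p < n" "v = snd (relator p)" by (simp_all flip: \<open>(u, v) = relator p\<close>)
    have "track v = ((replicate (Suc p) X1, \<lambda>x. if x = X0 then Suc p - p else p), True)"
      using track_up_down[of p p] p by (simp add: relator_def)
    then show ?thesis using u track p by auto
  qed
  moreover have "track v = ((r, d), e)" using u track by simp
  ultimately show ?case
    using overflows_track[OF u, of s] overflows_track[of v r d e s] relation.prems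
      apply_word_track[OF u, of s] apply_word_track[of v r d e s] by simp
next
  case (compatible u v u' v')
  then show ?case by (simp add: overflows_append)
qed auto

lemma track_down:
  "track (word_power [F0, F1] p) = ((replicate p X0, \<lambda>x. if x = X0 then 0 else p), False)"
proof (induction p)
  case 0
  show ?case by auto
next
  case (Suc p)
  have "track (word_power [F0, F1] (Suc p)) =
    track_step (track_step (track (word_power [F0, F1] p)) F0) F1"
    using track_snoc2[of "word_power [F0, F1] p" F0 F1] by (simp only: word_power_snoc)
  then show ?case unfolding Suc.IH
    by (auto simp: dec_apply inc_apply letter_fun_eq_iff replicate_append_same)
qed

lemma track_down_up:
  assumes "p \<le> n"
  shows "track (word_power [F0, F1] n @ word_power [F1, F0] p) =
    ((replicate n X0, \<lambda>x. if x = X0 then p else n - p), False)"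
  using assms
proof (induction p)
  case 0
  show ?case using track_down[of n] by (auto simp: letter_fun_eq_iff)
next
  case (Suc p)
  have "track (word_power [F0, F1] n @ word_power [F1, F0] (Suc p)) =
    track_step (track_step (track (word_power [F0, F1] n @ word_power [F1, F0] p)) F1) F0"
    using track_snoc2[of "word_power [F0, F1] n @ word_power [F1, F0] p" F1 F0]
    by (simp only: word_power_snoc append_assoc)
  also have "\<dots> = ((replicate n X0, \<lambda>x. if x = X0 then Suc p else n - Suc p), False)"
    using Suc.prems unfolding Suc.IH[OF Suc_leD[OF Suc.prems]]
    by (auto simp: dec_apply inc_apply letter_fun_eq_iff)
  finally show ?case .
qed

text \<open>The walk \<open>b\<^sup>n c\<^sup>n\<close> sends everything to \<open>X0\<^sup>n\<close>, so the initial \<open>f1\<close> of either side overflows once. On the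
input \<open>X0\<^sup>n\<close> the walk itself does not overflow, whereas the final \<open>f1 f1\<close> of the left side does.\<close>

lemma relator_notin_truncated: "relator n \<notin> truncated_congruence n"
proof
  assume "relator n \<in> truncated_congruence n"
  let ?w = "word_power [F0, F1] n @ word_power [F1, F0] n"
  let ?s = "replicate n X0"
  have w: "track ?w = ((replicate n X0, \<lambda>x. if x = X0 then n else n - n), False)"
    by (rule track_down_up) simp
  have const: "apply_word ?w t = ?s" if "length t = n" for t
    using apply_word_const[of t ?w] w that by (simp add: records_def)
  have rel: "relator n = ([F1] @ ?w @ [F1, F1], [F1] @ ?w)" by (simp add: relator_def)
  have "overflows ([F1] @ ?w @ [F1, F1]) ?s = overflows ([F1] @ ?w) ?s"
    using truncated_congruence_sound[of "fst (relator n)" "snd (relator n)" n ?s]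
      \<open>relator n \<in> _\<close> unfolding rel by simp
  moreover have "overflows ([F1] @ ?w) ?s = overflows [F1] ?s + overflows ?w ?s"
    unfolding overflows_append using const[of ?s] by simp
  moreover have "overflows ?w ?s = 0"
    using overflows_track[OF w, of ?s] count_list_total[of ?s X0] by (simp add: missing_def flip_def count_list_0_iff)
  moreover have "overflows ([F1] @ ?w @ [F1, F1]) ?s \<ge> overflows [F1] ?s + overflows [F1, F1] ?s"
    unfolding overflows_append using const[of "apply_word [F1, F1] ?s"] by simp
  moreover have "overflows [F1, F1] ?s \<ge> 1" by simp
  ultimately show False by linarith
qed

lemma truncated_congruence_mono:
  assumes "(u, v) \<in> truncated_congruence m" "m \<le> n"
  shows "(u, v) \<in> truncated_congruence n"
  using assms(1) unfolding truncated_congruence_def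
proof (induction rule: generated_congruence.induct)
  case (relation u v)
  then show ?case using assms(2) by (intro generated_congruence.relation) auto
next
  case (reflexive u)
  then show ?case by (rule generated_congruence.reflexive)
next
  case (symmetric u v)
  show ?case by (rule generated_congruence.symmetric[OF symmetric.IH])
next
  case (transitive u v w)
  show ?case by (rule generated_congruence.transitive[OF transitive.IH])
next
  case (compatible u v u' v')
  show ?case by (rule generated_congruence.compatible[OF compatible.IH])
qed

lemma truncated_congruence_exhausts:
  assumes "(u, v) \<in> generated_congruence UNIV ({([F0, F0], [])} \<union> range relator)"
  shows "\<exists>n. (u, v) \<in> truncated_congruence n"
  using assms
proof (induction rule: generated_congruence.induct)
  case (relation u v)
  show ?case
  proof (cases "(u, v) = ([F0, F0], [])")
    case True
    then show ?thesis unfolding truncated_congruence_def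
      by (intro exI[of _ 0] generated_congruence.relation) simp
  next
    case False
    then obtain p where "(u, v) = relator p" using relation by auto
    then show ?thesis unfolding truncated_congruence_def
      by (intro exI[of _ "Suc p"] generated_congruence.relation) simp
  qed
next
  case (reflexive u)
  show ?case unfolding truncated_congruence_def
    by (intro exI generated_congruence.reflexive reflexive)
next
  case (symmetric u v)
  then show ?case unfolding truncated_congruence_def
    by (blast intro: generated_congruence.symmetric)
next
  case (transitive u v w)
  then obtain m n where "(u, v) \<in> truncated_congruence m" "(v, w) \<in> truncated_congruence n"
    by blast
  then have "(u, v) \<in> truncated_congruence (max m n)" "(v, w) \<in> truncated_congruence (max m n)"
    by (auto intro: truncated_congruence_mono)
  then show ?case unfolding truncated_congruence_def
    by (blast intro: generated_congruence.transitive)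
next
  case (compatible u v u' v')
  then obtain m n where "(u, v) \<in> truncated_congruence m" "(u', v') \<in> truncated_congruence n"
    by blast
  then have "(u, v) \<in> truncated_congruence (max m n)" "(u', v') \<in> truncated_congruence (max m n)"
    by (auto intro: truncated_congruence_mono)
  then show ?case unfolding truncated_congruence_def
    by (blast intro: generated_congruence.compatible)
qed

text \<open>A derivation uses only finitely many relations.\<close>

lemma automaton_value_eq_truncated:
  assumes "finite P" "\<And>u v. (u, v) \<in> P \<Longrightarrow> automaton_value u = automaton_value v"
  shows "\<exists>n. P \<subseteq> truncated_congruence n"
  using assms
proof (induction P rule: finite_induct)
  case empty
  then show ?case by simp
next
  case (insert p P)
  obtain u v where p: "p = (u, v)" by (cases p)
  have "(u, v) \<in> generated_congruence UNIV ({([F0, F0], [])} \<union> range relator)"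
    using has_presentationD(5)[OF presentation_automaton_semigroup, of u v] insert.prems[of u v] p
    by simp
  then obtain m where m: "(u, v) \<in> truncated_congruence m"
    using truncated_congruence_exhausts by blast
  obtain n where n: "P \<subseteq> truncated_congruence n" using insert by blast
  have "insert p P \<subseteq> truncated_congruence (max m n)"
    using m n p truncated_congruence_mono[of _ _ m "max m n"]
      truncated_congruence_mono[of _ _ n "max m n"] by auto
  then show ?case by blast
qed

lemma substitution_closed:
  assumes "\<And>x. x \<in> X \<Longrightarrow> word_value M g (a x) = h x"
    and "\<And>x. x \<in> X \<Longrightarrow> a x \<in> lists Y" and M: "monoid M" "g ` Y \<subseteq> carrier M"
    and "w \<in> lists X"
  shows "concat (map a w) \<in> lists Y \<and> word_value M g (concat (map a w)) = word_value M h w"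
  using assms(5)
proof (induction rule: lists.induct)
  case Nil
  then show ?case by simp
next
  case (Cons x w)
  then show ?case
    using word_value_append[OF M assms(2)[OF Cons.hyps(1)], of "concat (map a w)"]
      assms(1,2)[OF Cons.hyps(1)]
    by simp
qed

text \<open>Translating words back and forth between the generators \<open>f0\<close>, \<open>f1\<close> and those of a hypothetical finite
presentation uses finitely many valid equations: the translated relations and the two equations
that express \<open>f0\<close> and \<open>f1\<close> through themselves. If these hold modulo the relators below \<open>n\<close>, so do all
valid equations, including the relator \<open>n\<close>.\<close>

theorem not_finitely_presented: "\<not> finitely_presented automaton_semigroup"
proof
  let ?M = automaton_semigroup
  assume "finitely_presented ?M"
  then obtain X :: "nat set" and R g where fin: "finite X" "finite R"
    and pres: "has_presentation ?M g X R"
    by (auto simp: finitely_presented_def)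
  note D = has_presentationD[OF pres]
  have gen: "act ` UNIV \<subseteq> carrier ?M"
    by (rule has_presentationD(3)[OF presentation_automaton_semigroup])
  have "\<exists>w. automaton_value w = g x" if "x \<in> X" for x
  proof -
    have "g x \<in> range automaton_value"
      using D(3) that unfolding carrier_automaton_semigroup by blast
    then show ?thesis by (metis imageE)
  qed
  then obtain a where a: "\<And>x. x \<in> X \<Longrightarrow> automaton_value (a x) = g x" by metis
  have "\<exists>w. w \<in> lists X \<and> word_value ?M g w = act q" for q
    using D(4)[of "act q"] gen by blast
  then obtain b where b: "\<And>q. b q \<in> lists X" "\<And>q. word_value ?M g (b q) = act q" by metis
  define A where "A = (\<lambda>w. concat (map a w))"
  define B where "B = (\<lambda>w. concat (map b w))"
  have A: "automaton_value (A w) = word_value ?M g w" if "w \<in> lists X" for w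
    using substitution_closed[OF a _ D(1) gen that] by (simp add: A_def)
  have B: "B w \<in> lists X \<and> word_value ?M g (B w) = automaton_value w" for w
    using substitution_closed[OF b(2) b(1) D(1) D(3), of w UNIV] by (simp add: B_def)
  let ?P = "(\<lambda>(u, v). (A u, A v)) ` R \<union> {([F0], A (b F0)), ([F1], A (b F1))}"
  have "automaton_value u = automaton_value v" if "(u, v) \<in> ?P" for u v
  proof -
    from that consider u' v' where "(u', v') \<in> R" "u = A u'" "v = A v'"
      | q where "u = [q]" "v = A (b q)" by auto
    then show ?thesis
    proof cases
      case 1
      then have "u' \<in> lists X" "v' \<in> lists X" using D(2) by auto
      moreover have "word_value ?M g u' = word_value ?M g v'"
        using D(5)[OF \<open>u' \<in> lists X\<close> \<open>v' \<in> lists X\<close>] 1 generated_congruence.relation by metis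
      ultimately show ?thesis using A 1 by simp
    next
      case 2
      then show ?thesis using A[OF b(1)] b(2)[of q] by simp
    qed
  qed
  moreover have "finite ?P" using fin by simp
  ultimately obtain n where n: "?P \<subseteq> truncated_congruence n"
    using automaton_value_eq_truncated by metis
  have AR: "(A u, A v) \<in> truncated_congruence n" if "(u, v) \<in> generated_congruence X R" for u v
    using that
  proof (induction rule: generated_congruence.induct)
    case (relation u v)
    then show ?case using n by force
  next
    case (reflexive u)
    show ?case unfolding truncated_congruence_def by (rule generated_congruence.reflexive) simp
  next
    case (symmetric u v)
    from symmetric.IH show ?case
      unfolding truncated_congruence_def by (rule generated_congruence.symmetric)
  next
    case (transitive u v w)
    from transitive.IH show ?case
      unfolding truncated_congruence_def by (rule generated_congruence.transitive)
  next
    case (compatible u v u' v')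
    have "A (u @ u') = A u @ A u'" "A (v @ v') = A v @ A v'" by (simp_all add: A_def)
    then show ?case using compatible.IH unfolding truncated_congruence_def
      by (simp only: generated_congruence.compatible)
  qed
  have AB: "(w, A (B w)) \<in> truncated_congruence n" for w
  proof (induction w)
    case Nil
    show ?case unfolding truncated_congruence_def A_def B_def
      by (simp add: generated_congruence.reflexive)
  next
    case (Cons q w)
    have "([q], A (b q)) \<in> truncated_congruence n" using n by (cases q) auto
    then have "([q] @ w, A (b q) @ A (B w)) \<in> truncated_congruence n"
      using Cons.IH unfolding truncated_congruence_def by (rule generated_congruence.compatible)
    then show ?case by (simp add: A_def B_def)
  qed
  obtain u v where uv: "relator n = (u, v)" by (cases "relator n")
  have "track u = track v" by (rule track_eq_of_relation) (simp add: uv[symmetric])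
  then have "automaton_value u = automaton_value v" by (simp only: automaton_value_eq_iff)
  then have "(B u, B v) \<in> generated_congruence X R"
    using D(5)[of "B u" "B v"] B[of u] B[of v] by (simp del: in_lists_conv_set)
  then have "(A (B u), A (B v)) \<in> truncated_congruence n" by (rule AR)
  then have "(u, v) \<in> truncated_congruence n"
    using AB[of u] AB[of v] unfolding truncated_congruence_def
    by (blast intro: generated_congruence.transitive generated_congruence.symmetric)
  then show False using relator_notin_truncated[of n] uv by simp
qed

section \<open>A Turing machine for the word problem\<close>

primrec letter_code :: "letter \<Rightarrow> nat" where
  "letter_code X0 = 1"
| "letter_code X1 = 2"

text \<open>The machine has seven tapes: the input, and for each of the two words a counter for \<open>d X0\<close>, a
counter for \<open>d X1\<close> and a tape for the records. A counter holds the mark \<open>1\<close> in its cell number \<open>0\<close>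
and blanks elsewhere, and the value is the position of the head; it is zero if the head reads \<open>1\<close>.
Every input letter takes one step.\<close>

definition keep :: "nat \<Rightarrow> nat \<times> move" where
  "keep s = (s, Stay)"

text \<open>As \<open>dec\<close> does, this leaves a counter with value zero unchanged.\<close>

definition down :: "nat \<Rightarrow> nat \<times> move" where
  "down s = (if s = 1 then (s, Stay) else (s, Move_Left))"

definition update_actions :: "bool \<Rightarrow> nat \<Rightarrow> nat \<Rightarrow> nat \<Rightarrow> nat \<Rightarrow> (nat \<times> move) list" where
  "update_actions e a i j r =
    (if a \<noteq> 2 then [keep i, keep j, keep r]
     else if e then [down i, (j, Move_Right), if i = 1 then (1, Move_Right) else keep r]
     else [(i, Move_Right), down j, if j = 1 then (2, Move_Right) else keep r])"

text \<open>While the first word is read, the state holds the parity of what has been read; while the second word is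
read, it also holds the parity of the first. The other states are: 0 the start, which writes the marks
on the counters; 7 the turning of the record tapes; 8 the comparison; 9 acceptance; 10 rejection.\<close>

definition first_state :: "bool \<Rightarrow> nat" where
  "first_state e = (if e then 2 else 1)"

definition second_state :: "bool \<Rightarrow> bool \<Rightarrow> nat" where
  "second_state e' e = (if e' then 5 else 3) + (if e then 1 else 0)"

fun transition :: "nat \<Rightarrow> nat list \<Rightarrow> nat \<times> (nat \<times> move) list" where
  "transition q [a, i, j, r, i', j', r'] =
    (if q = 0 then (first_state False,
       [keep a, (1, Stay), (1, Stay), keep r, (1, Stay), (1, Stay), keep r'])
     else if q = 1 \<or> q = 2 then
       (if a = 3 then (second_state (q = 2) False,
          [(a, Move_Right), keep i, keep j, keep r, keep i', keep j', keep r'])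
        else (first_state (q \<noteq> 2),
          (a, Move_Right) # update_actions (q = 2) a i j r @ [keep i', keep j', keep r']))
     else if 3 \<le> q \<and> q \<le> 6 then
       (if a = 0 then (if q = 3 \<or> q = 6 then 7 else 10,
          [keep a, keep i, keep j, keep r, keep i', keep j', keep r'])
        else (second_state (5 \<le> q) (q \<noteq> 4 \<and> q \<noteq> 6),
          [(a, Move_Right), keep i, keep j, keep r] @ update_actions (q = 4 \<or> q = 6) a i' j' r'))
     else if q = 7 then
       (8, [keep a, keep i, keep j, (r, Move_Left), keep i', keep j', (r', Move_Left)])
     else if r = r' \<and> i = i' then
       (if r = 0 then 9 else 8,
        [keep a, down i, keep j, (r, Move_Left), down i', keep j', (r', Move_Left)])
     else (10, [keep a, keep i, keep j, keep r, keep i', keep j', keep r']))"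
| "transition q _ = (10, [])"

definition comparer :: machine where
  "comparer = \<lparr>tape_count = 7, state_count = 11, symbol_count = 4, start = 0, accept = 9,
    reject = 10, delta = transition\<rparr>"

lemma length_7E:
  assumes "length ss = 7"
  obtains a i j r i' j' r' where "ss = [a, i, j, r, i', j', r']"
  using assms by (auto simp: numeral_eq_Suc length_Suc_conv)

lemma turing_machine_comparer: "turing_machine comparer"
proof -
  have *: "fst (transition q ss) < 11 \<and> length (snd (transition q ss)) = 7 \<and>
      (\<forall>(s, m) \<in> set (snd (transition q ss)). s < 4)"
    if "length ss = 7" "set ss \<subseteq> {..<4}" for q ss
  proof -
    obtain a i j r i' j' r' where ss: "ss = [a, i, j, r, i', j', r']"
      using \<open>length ss = 7\<close> by (rule length_7E)
    show ?thesis using that(2)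
      unfolding ss by (auto simp: first_state_def second_state_def keep_def down_def update_actions_def)
  qed
  show ?thesis unfolding turing_machine_def comparer_def
    by simp (use * in blast)
qed

definition perform :: "nat \<times> move \<Rightarrow> tape \<Rightarrow> tape" where
  "perform = (\<lambda>(s, m) t. move_head m (write_tape s t))"

lemma step_comparer:
  "q < 9 \<Longrightarrow> step comparer (q, ts) =
    (fst (transition q (map read_tape ts)), map2 perform (snd (transition q (map read_tape ts))) ts)"
  by (simp add: comparer_def perform_def split: prod.splits)

text \<open>The trailing blanks depend on the past of the computation and are left open.\<close>

definition counter_tape :: "nat \<Rightarrow> tape \<Rightarrow> bool" where
  "counter_tape n t \<longleftrightarrow> (\<exists>k. t =
    (case n of 0 \<Rightarrow> ([], 1 # replicate k 0) | Suc m \<Rightarrow> (replicate m 0 @ [1], replicate k 0)))"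

definition record_tape :: "letter list \<Rightarrow> tape \<Rightarrow> bool" where
  "record_tape r t \<longleftrightarrow> (\<exists>k. t = (map letter_code (rev r), replicate k 0))"

lemma top_symbol_simps [simp]: "top_symbol [] = 0" "top_symbol (x # xs) = x"
  by (simp_all add: top_symbol_def)

lemma top_symbol_replicate [simp]: "top_symbol (replicate k 0) = 0"
  by (cases k) auto

lemma read_counter: "counter_tape n t \<Longrightarrow> read_tape t = (if n = 0 then 1 else 0)"
  by (cases n) (auto simp: counter_tape_def read_tape_def)

lemma counter_keep:
  assumes "counter_tape n t" shows "counter_tape n (perform (keep (read_tape t)) t)"
  using assms unfolding counter_tape_def perform_def keep_def read_tape_def
  by (cases n) (auto simp flip: replicate_Suc)

lemma counter_up:
  assumes "counter_tape n t" shows "counter_tape (Suc n) (perform (read_tape t, Move_Right) t)"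
  using assms unfolding counter_tape_def perform_def read_tape_def
  by (cases n) auto

lemma counter_down:
  assumes "counter_tape n t" shows "counter_tape (n - 1) (perform (down (read_tape t)) t)"
proof (cases n)
  case 0
  then show ?thesis
    using assms unfolding counter_tape_def perform_def down_def read_tape_def by auto
next
  case (Suc m)
  then obtain k where t: "t = (replicate m 0 @ [1], replicate k 0)"
    using assms by (auto simp: counter_tape_def)
  have down: "down (read_tape t) = (0, Move_Left)" by (simp add: t down_def read_tape_def)
  show ?thesis
  proof (cases m)
    case 0
    then show ?thesis using Suc unfolding down unfolding counter_tape_def perform_def t
      by (auto simp flip: replicate_Suc)
  next
    case (Suc m')
    then show ?thesis using \<open>n = Suc m\<close> unfolding down unfolding counter_tape_def perform_def t
      by (auto intro: exI[of _ "Suc (Suc (k - 1))"])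
  qed
qed

lemma record_keep:
  assumes "record_tape r t" shows "record_tape r (perform (keep (read_tape t)) t)"
  using assms unfolding record_tape_def perform_def keep_def read_tape_def
  by (auto simp flip: replicate_Suc)

lemma record_append:
  assumes "record_tape r t"
  shows "record_tape (r @ [x]) (perform (letter_code x, Move_Right) t)"
  using assms unfolding record_tape_def perform_def by auto

definition stored :: "history \<Rightarrow> tape list \<Rightarrow> bool" where
  "stored h ts \<longleftrightarrow> (\<exists>ti tj tr. ts = [ti, tj, tr] \<and>
    counter_tape (snd h X0) ti \<and> counter_tape (snd h X1) tj \<and> record_tape (fst h) tr)"

lemma stored_keep:
  assumes "stored h [ti, tj, tr]"
  shows "stored h [perform (keep (read_tape ti)) ti, perform (keep (read_tape tj)) tj,
    perform (keep (read_tape tr)) tr]"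
  using assms by (auto simp: stored_def intro: counter_keep record_keep)

lemma stored_update:
  assumes st: "stored h [ti, tj, tr]"
  shows "\<exists>ti' tj' tr'. map2 perform (update_actions e (symbol_code q) (read_tape ti) (read_tape tj) (read_tape tr))
     [ti, tj, tr] = [ti', tj', tr'] \<and> stored (fst (track_step (h, e) q)) [ti', tj', tr']"
proof -
  obtain r d where h: "h = (r, d)" by (cases h)
  have t: "counter_tape (d X0) ti" "counter_tape (d X1) tj" "record_tape r tr"
    using st by (auto simp: stored_def h)
  show ?thesis
  proof (cases q)
    case F0
    then show ?thesis using stored_keep[OF st] by (simp add: update_actions_def)
  next
    case F1
    show ?thesis
    proof (cases e)
      case True
      have "inc (opposite X0) (dec X0 1 d) X0 = d X0 - 1"
        "inc (opposite X0) (dec X0 1 d) X1 = Suc (d X1)"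
        by (simp_all add: inc_apply dec_apply)
      then show ?thesis
        using t F1 True read_counter[OF t(1)] counter_down[OF t(1)] counter_up[OF t(2)]
          record_keep[OF t(3)] record_append[OF t(3), of X0]
        by (auto simp: update_actions_def h stored_def)
    next
      case False
      have "inc (opposite X1) (dec X1 1 d) X0 = Suc (d X0)"
        "inc (opposite X1) (dec X1 1 d) X1 = d X1 - 1"
        by (simp_all add: inc_apply dec_apply)
      then show ?thesis
        using t F1 False read_counter[OF t(2)] counter_up[OF t(1)] counter_down[OF t(2)]
          record_keep[OF t(3)] record_append[OF t(3), of X1]
        by (auto simp: update_actions_def h stored_def)
    qed
  qed
qed

lemma update_actions_eq:
  "\<exists>x y z. update_actions e a i j r = [x, y, z]"
  by (simp add: update_actions_def)

lemma symbol_code_cases: "symbol_code q \<noteq> 0" "symbol_code q \<noteq> 3"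
  by (cases q; simp)+

lemma step_first:
  assumes "stored h ts" "stored h' ts'"
  shows "\<exists>us us'. step comparer (first_state e, (l, symbol_code q # rest) # ts @ ts') =
      (first_state (\<not> e), (symbol_code q # l, rest) # us @ us') \<and>
      stored (fst (track_step (h, e) q)) us \<and> stored h' us'"
proof -
  obtain ti tj tr where ts: "ts = [ti, tj, tr]" using assms(1) by (auto simp: stored_def)
  obtain ti' tj' tr' where ts': "ts' = [ti', tj', tr']" using assms(2) by (auto simp: stored_def)
  let ?acts = "update_actions e (symbol_code q) (read_tape ti) (read_tape tj) (read_tape tr)"
  obtain x y z where acts: "?acts = [x, y, z]" using update_actions_eq by blast
  have st: "stored (fst (track_step (h, e) q)) [perform x ti, perform y tj, perform z tr]"
    using stored_update[of h ti tj tr e q] assms(1) unfolding ts acts by auto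
  have read: "read_tape (l, symbol_code q # rest) = symbol_code q" by (simp add: read_tape_def)
  have e: "(first_state e = 2) = e" "first_state e = 1 \<or> first_state e = 2" "first_state e < 9"
    "first_state e \<noteq> 0"
    by (auto simp: first_state_def)
  have "transition (first_state e)
      (map read_tape ((l, symbol_code q # rest) # ts @ ts')) =
    (first_state (\<not> e), [(symbol_code q, Move_Right), x, y, z,
      keep (read_tape ti'), keep (read_tape tj'), keep (read_tape tr')])"
    using e symbol_code_cases[of q] acts by (simp add: ts ts' read)
  then have "step comparer (first_state e, (l, symbol_code q # rest) # ts @ ts') =
      (first_state (\<not> e), (symbol_code q # l, rest) # [perform x ti, perform y tj, perform z tr] @
        [perform (keep (read_tape ti')) ti', perform (keep (read_tape tj')) tj',
         perform (keep (read_tape tr')) tr'])"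
    unfolding step_comparer[OF e(3)] by (simp add: ts ts' perform_def)
  then show ?thesis using st stored_keep assms(2) unfolding ts' by blast
qed

lemma step_second:
  assumes "stored h ts" "stored h' ts'"
  shows "\<exists>us us'. step comparer (second_state e' e, (l, symbol_code q # rest) # ts @ ts') =
      (second_state e' (\<not> e), (symbol_code q # l, rest) # us @ us') \<and>
      stored h us \<and> stored (fst (track_step (h', e) q)) us'"
proof -
  obtain ti tj tr where ts: "ts = [ti, tj, tr]" using assms(1) by (auto simp: stored_def)
  obtain ti' tj' tr' where ts': "ts' = [ti', tj', tr']" using assms(2) by (auto simp: stored_def)
  let ?acts = "update_actions e (symbol_code q) (read_tape ti') (read_tape tj') (read_tape tr')"
  obtain x y z where acts: "?acts = [x, y, z]" using update_actions_eq by blast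
  have st: "stored (fst (track_step (h', e) q)) [perform x ti', perform y tj', perform z tr']"
    using stored_update[of h' ti' tj' tr' e q] assms(2) unfolding ts' acts by auto
  have read: "read_tape (l, symbol_code q # rest) = symbol_code q" by (simp add: read_tape_def)
  have e: "second_state e' e < 9" by (simp add: second_state_def)
  have "transition (second_state e' e)
      (map read_tape ((l, symbol_code q # rest) # ts @ ts')) =
    (second_state e' (\<not> e), [(symbol_code q, Move_Right),
      keep (read_tape ti), keep (read_tape tj), keep (read_tape tr), x, y, z])"
    using symbol_code_cases[of q] acts by (cases e; cases e') (simp_all add: ts ts' read second_state_def)
  then have "step comparer (second_state e' e, (l, symbol_code q # rest) # ts @ ts') =
      (second_state e' (\<not> e), (symbol_code q # l, rest) #
        [perform (keep (read_tape ti)) ti, perform (keep (read_tape tj)) tj,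
         perform (keep (read_tape tr)) tr] @ [perform x ti', perform y tj', perform z tr'])"
    unfolding step_comparer[OF e] by (simp add: ts ts' perform_def)
  then show ?thesis using st stored_keep assms(1) unfolding ts by blast
qed

lemma steps_first:
  assumes "stored h ts" "stored h' ts'"
  shows "\<exists>l' us us'. (step comparer ^^ length w) (first_state e, (l, map symbol_code w @ rest) # ts @ ts') =
      (first_state (snd (foldl track_step (h, e) w)), (l', rest) # us @ us') \<and>
      stored (fst (foldl track_step (h, e) w)) us \<and> stored h' us'"
  using assms
proof (induction w arbitrary: h e l ts ts')
  case Nil
  then show ?case by auto
next
  case (Cons q w)
  obtain us us' where s: "step comparer (first_state e, (l, symbol_code q # map symbol_code w @ rest) # ts @ ts') =
      (first_state (\<not> e), (symbol_code q # l, map symbol_code w @ rest) # us @ us')"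
      "stored (fst (track_step (h, e) q)) us" "stored h' us'"
    using step_first[OF Cons.prems] by blast
  have tr: "track_step (h, e) q = (fst (track_step (h, e) q), \<not> e)" by (cases q) auto
  show ?case
    using Cons.IH[OF s(2,3), of "\<not> e" "symbol_code q # l"] s(1) tr
    by (simp add: funpow_swap1 del: step.simps track_step.simps)
qed

lemma steps_second:
  assumes "stored h ts" "stored h' ts'"
  shows "\<exists>l' us us'. (step comparer ^^ length w) (second_state e' e, (l, map symbol_code w @ rest) # ts @ ts') =
      (second_state e' (snd (foldl track_step (h', e) w)), (l', rest) # us @ us') \<and>
      stored h us \<and> stored (fst (foldl track_step (h', e) w)) us'"
  using assms
proof (induction w arbitrary: h' e l ts ts')
  case Nil
  then show ?case by auto
next
  case (Cons q w)
  obtain us us' where s: "step comparer (second_state e' e, (l, symbol_code q # map symbol_code w @ rest) # ts @ ts') =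
      (second_state e' (\<not> e), (symbol_code q # l, map symbol_code w @ rest) # us @ us')"
      "stored h us" "stored (fst (track_step (h', e) q)) us'"
    using step_second[OF Cons.prems] by blast
  have tr: "track_step (h', e) q = (fst (track_step (h', e) q), \<not> e)" by (cases q) auto
  show ?case
    using Cons.IH[OF s(2,3), of "\<not> e" "symbol_code q # l"] s(1) tr
    by (simp add: funpow_swap1 del: step.simps track_step.simps)
qed

text \<open>During the comparison the records are read from the last one backwards. Here \<open>s\<close> is what remains
to be read, and the cells that have been read are left open.\<close>

definition unread_tape :: "nat list \<Rightarrow> tape \<Rightarrow> bool" where
  "unread_tape s t \<longleftrightarrow> (\<exists>z. t = (tl s, top_symbol s # z))"

lemma read_unread: "unread_tape s t \<Longrightarrow> read_tape t = top_symbol s"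
  by (auto simp: unread_tape_def read_tape_def)

lemma unread_left:
  "unread_tape s t \<Longrightarrow> unread_tape (tl s) (perform (read_tape t, Move_Left) t)"
  by (auto simp: unread_tape_def read_tape_def perform_def)

lemma record_left:
  "record_tape r t \<Longrightarrow> unread_tape (map letter_code (rev r)) (perform (read_tape t, Move_Left) t)"
  by (auto simp: unread_tape_def record_tape_def read_tape_def perform_def)

text \<open>The counters are counted down together with the records. As no value exceeds the number of
records, a difference of the values shows up before the records are exhausted, and the end of the record
tapes decides.\<close>

lemma steps_compare:
  assumes "unread_tape s tr" "unread_tape s' tr'" "counter_tape n ti" "counter_tape n' ti'"
    and "n \<le> length s" "n' \<le> length s'" "0 \<notin> set s" "0 \<notin> set s'"
  shows "\<exists>t \<le> Suc (length s). fst ((step comparer ^^ t) (8, [ta, ti, tj, tr, ti', tj', tr'])) =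
    (if s = s' \<and> n = n' then 9 else 10)"
  using assms
proof (induction s arbitrary: s' n n' ta ti tj tr ti' tj' tr')
  case Nil
  let ?c = "(8, [ta, ti, tj, tr, ti', tj', tr'])"
  have "fst (step comparer ?c) = (if s' = [] \<and> n = n' then 9 else 10)"
    using Nil read_unread[OF Nil(1)] read_unread[OF Nil(2)] read_counter[OF Nil(3)] read_counter[OF Nil(4)]
    by (cases s') (auto simp: step_comparer simp del: step.simps)
  then show ?case by (intro exI[of _ 1]) auto
next
  case (Cons x s)
  let ?c = "(8, [ta, ti, tj, tr, ti', tj', tr'])"
  have x: "x \<noteq> 0" using Cons.prems by auto
  note reads = read_unread[OF Cons.prems(1)] read_unread[OF Cons.prems(2)]
    read_counter[OF Cons.prems(3)] read_counter[OF Cons.prems(4)]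
  show ?case
  proof (cases "top_symbol s' = x \<and> (n = 0) = (n' = 0)")
    case False
    then have "fst (step comparer ?c) = 10"
      using reads by (auto simp: step_comparer simp del: step.simps)
    moreover have "\<not> (x # s = s' \<and> n = n')" using False by auto
    ultimately show ?thesis by (intro exI[of _ 1]) auto
  next
    case True
    then obtain s1 where s': "s' = x # s1" using x by (cases s') auto
    let ?c' = "(8, [perform (keep (read_tape ta)) ta, perform (down (read_tape ti)) ti,
      perform (keep (read_tape tj)) tj, perform (read_tape tr, Move_Left) tr,
      perform (down (read_tape ti')) ti', perform (keep (read_tape tj')) tj',
      perform (read_tape tr', Move_Left) tr'])"
    have step: "step comparer ?c = ?c'"
      using reads True x by (simp add: step_comparer del: step.simps)
    have "\<exists>t \<le> Suc (length s). fst ((step comparer ^^ t) ?c') =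
        (if s = s1 \<and> n - 1 = n' - 1 then 9 else 10)"
      using Cons.prems s' unread_left[OF Cons.prems(1)] unread_left[OF Cons.prems(2)]
      by (intro Cons.IH counter_down) auto
    then obtain t where t: "t \<le> Suc (length s)" "fst ((step comparer ^^ t) ?c') =
        (if s = s1 \<and> n - 1 = n' - 1 then 9 else 10)" by blast
    have "n - 1 = n' - 1 \<longleftrightarrow> n = n'" using True by auto
    then show ?thesis using t step s'
      by (intro exI[of _ "Suc t"]) (auto simp: funpow_Suc_right simp del: step.simps funpow.simps)
  qed
qed

lemma length_records_le: "length (fst (fst (track w))) \<le> length w"
proof (induction w rule: rev_induct)
  case (snoc q w)
  obtain r d e where "track w = ((r, d), e)" by (rule track_cases)
  then show ?case using snoc by (cases q) auto
qed simp

text \<open>Equality of records, parities and the distances in direction \<open>X0\<close> suffices, as the two distances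
add up to the number of records.\<close>

lemma comparer_correct:
  "\<exists>t \<le> 2 * length u + length v + 5. fst ((step comparer ^^ t) (initial comparer (encode_pair (u, v)))) =
    (if track u = track v then 9 else 10)"
proof -
  let ?u = "map symbol_code u" and ?v = "map symbol_code v"
  let ?S = "step comparer"
  have blank: "stored ([], \<lambda>_. 0) [([], [1]), ([], [1]), ([], [0])]"
    by (auto simp: stored_def counter_tape_def record_tape_def intro: exI[of _ 0] exI[of _ 1])
  obtain r d e where u: "track u = ((r, d), e)" by (rule track_cases)
  obtain r' d' e' where v: "track v = ((r', d'), e')" by (rule track_cases)
  define c1 where "c1 = ?S (initial comparer (encode_pair (u, v)))"
  have c1: "c1 = (first_state False, ([], ?u @ 3 # ?v) #
      [([], [1]), ([], [1]), ([], [0])] @ [([], [1]), ([], [1]), ([], [0])])"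
  proof -
    have "initial comparer (encode_pair (u, v)) =
      (0, [([], ?u @ 3 # ?v), ([], []), ([], []), ([], []), ([], []), ([], []), ([], [])])"
      by (simp add: initial_def comparer_def encode_pair_def numeral_eq_Suc)
    moreover have "perform (keep (read_tape ([], ?u @ 3 # ?v))) ([], ?u @ 3 # ?v) = ([], ?u @ 3 # ?v)"
      by (cases u) (auto simp: perform_def keep_def read_tape_def)
    ultimately show ?thesis
      unfolding c1_def by (simp add: step_comparer perform_def keep_def read_tape_def del: step.simps)
  qed
  obtain l us us' where c2: "(?S ^^ length u) c1 = (first_state e, (l, 3 # ?v) # us @ us')"
    "stored (r, d) us" "stored ([], \<lambda>_. 0) us'"
    using steps_first[OF blank blank, of u False "[]" "3 # ?v"] u
    by (auto simp: c1 track_def simp del: step.simps)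
  obtain ti tj tr where us: "us = [ti, tj, tr]" using c2(2) by (auto simp: stored_def)
  obtain ti' tj' tr' where us': "us' = [ti', tj', tr']" using c2(3) by (auto simp: stored_def)
  define ws ws' where
    "ws = [perform (keep (read_tape ti)) ti, perform (keep (read_tape tj)) tj, perform (keep (read_tape tr)) tr]" and
    "ws' = [perform (keep (read_tape ti')) ti', perform (keep (read_tape tj')) tj', perform (keep (read_tape tr')) tr']"
  have ws: "stored (r, d) ws" "stored ([], \<lambda>_. 0) ws'"
    using stored_keep c2(2,3) unfolding us us' ws_def ws'_def by blast+
  have c3: "?S (first_state e, (l, 3 # ?v) # us @ us') = (second_state e False, (3 # l, ?v @ []) # ws @ ws')"
    by (cases e) (simp_all add: step_comparer first_state_def us us' ws_def ws'_def read_tape_def perform_def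
      del: step.simps)
  obtain l' vs vs' where c4: "(?S ^^ length v) (second_state e False, (3 # l, ?v @ []) # ws @ ws') =
      (second_state e e', (l', []) # vs @ vs')"
    "stored (r, d) vs" "stored (r', d') vs'"
    using steps_second[OF ws, of v e False "3 # l" "[]"] v
    by (auto simp: track_def simp del: step.simps)
  have upto: "(?S ^^ (length u + length v + 2)) (initial comparer (encode_pair (u, v))) =
      (second_state e e', (l', []) # vs @ vs')"
  proof -
    have "(?S ^^ (length v + Suc (length u + 1))) (initial comparer (encode_pair (u, v))) =
        (?S ^^ length v) (?S ((?S ^^ length u) c1))"
      unfolding c1_def by (simp add: funpow_add funpow_swap1 del: step.simps)
    then show ?thesis using c2(1) c3 c4(1) by (simp add: add.commute add.left_commute del: step.simps)
  qed
  obtain t1 t2 t3 where vs: "vs = [t1, t2, t3]" "counter_tape (d X0) t1" "record_tape r t3"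
    using c4(2) by (auto simp: stored_def)
  obtain t1' t2' t3' where vs': "vs' = [t1', t2', t3']" "counter_tape (d' X0) t1'" "record_tape r' t3'"
    using c4(3) by (auto simp: stored_def)
  let ?k = "\<lambda>t. perform (keep (read_tape t)) t" and ?l = "\<lambda>t. perform (read_tape t, Move_Left) t"
  let ?c = "(second_state e e', (l', []) # vs @ vs')"
  have "\<exists>t \<le> length r + 3. fst ((?S ^^ t) ?c) = (if track u = track v then 9 else 10)"
  proof (cases "e = e'")
    case False
    then have "fst (?S ?c) = 10"
      by (auto simp: step_comparer second_state_def vs(1) vs'(1) read_tape_def simp del: step.simps)
    then show ?thesis using False u v by (intro exI[of _ 1]) auto
  next
    case True
    have s1: "?S ?c = (7, ?k (l', []) # map ?k vs @ map ?k vs')"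
      using True
      by (auto simp: step_comparer second_state_def vs(1) vs'(1) read_tape_def simp del: step.simps)
    have s2: "?S (?S ?c) = (8, [?k (?k (l', [])), ?k (?k t1), ?k (?k t2), ?l (?k t3),
        ?k (?k t1'), ?k (?k t2'), ?l (?k t3')])"
      unfolding s1 by (simp add: step_comparer vs(1) vs'(1) del: step.simps)
    have len: "d X0 \<le> length (map letter_code (rev r))" "d' X0 \<le> length (map letter_code (rev r'))"
      using total_track[of u] total_track[of v] u v by (auto simp: records_def total_def)
    have nz: "0 \<notin> set (map letter_code (rev s))" for s
    proof -
      have "letter_code x \<noteq> 0" for x by (cases x) auto
      then show ?thesis by (metis (no_types, lifting) imageE list.set_map)
    qed
    have inj: "map letter_code (rev r) = map letter_code (rev r') \<longleftrightarrow> r = r'"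
    proof -
      have "inj letter_code"
      proof (rule injI)
        fix x y assume "letter_code x = letter_code y"
        then show "x = y" by (cases x; cases y) auto
      qed
      then show ?thesis by (simp add: inj_map_eq_map)
    qed
    have same: "r = r' \<and> d X0 = d' X0 \<longleftrightarrow> track u = track v"
    proof
      assume *: "r = r' \<and> d X0 = d' X0"
      then have "d X1 = d' X1"
        using total_track[of u] total_track[of v] u v by (simp add: records_def total_def)
      then show "track u = track v" using * u v True by (simp add: letter_fun_eq_iff)
    qed (use u v in auto)
    have "\<exists>t \<le> Suc (length (map letter_code (rev r))). fst ((?S ^^ t) (?S (?S ?c))) =
        (if map letter_code (rev r) = map letter_code (rev r') \<and> d X0 = d' X0 then 9 else 10)"
      unfolding s2
      by (rule steps_compare[OF record_left[OF record_keep[OF vs(3)]]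
        record_left[OF record_keep[OF vs'(3)]] counter_keep[OF counter_keep[OF vs(2)]]
        counter_keep[OF counter_keep[OF vs'(2)]] len nz nz])
    then obtain t where t: "t \<le> Suc (length r)"
        "fst ((?S ^^ t) (?S (?S ?c))) = (if track u = track v then 9 else 10)"
      unfolding inj same length_map length_rev by blast
    show ?thesis
    proof (intro exI conjI)
      show "t + 2 \<le> length r + 3" using t(1) by simp
      show "fst ((?S ^^ (t + 2)) ?c) = (if track u = track v then 9 else 10)"
      proof -
        have "(f ^^ (t + 2)) x = (f ^^ t) (f (f x))" for f :: "configuration \<Rightarrow> configuration" and x
          by (simp add: funpow_swap1)
        then show ?thesis using t(2) by (simp only:)
      qed
    qed
  qed
  then obtain t where t: "t \<le> length r + 3" "fst ((?S ^^ t) ?c) = (if track u = track v then 9 else 10)"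
    by blast
  show ?thesis
  proof (intro exI conjI)
    show "t + (length u + length v + 2) \<le> 2 * length u + length v + 5"
      using t(1) length_records_le[of u] u by simp
    show "fst ((?S ^^ (t + (length u + length v + 2))) (initial comparer (encode_pair (u, v)))) =
      (if track u = track v then 9 else 10)"
      unfolding funpow_add[of t] comp_apply upto by (rule t(2))
  qed
qed

theorem word_problem_polynomial:
  "decidable_in_polynomial_time encode_pair pair_size (word_problem automaton_semigroup act)"
  unfolding decidable_in_polynomial_time_def
proof (rule exI[of _ comparer], rule exI[of _ 5], rule exI[of _ 1], intro conjI allI)
  show "turing_machine comparer" by (rule turing_machine_comparer)
  fix p :: "state list \<times> state list"
  obtain u v where p: "p = (u, v)" by (cases p)
  have "0 < symbol_code q \<and> symbol_code q < 4" for q by (cases q) auto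
  then show "set (encode_pair p) \<subseteq> {0<..<symbol_count comparer}"
    by (auto simp: p encode_pair_def comparer_def)
  have "p \<in> word_problem automaton_semigroup act \<longleftrightarrow> track u = track v"
    by (simp add: p word_problem_def automaton_value_eq_iff)
  moreover obtain t where "t \<le> 2 * length u + length v + 5"
    "fst ((step comparer ^^ t) (initial comparer (encode_pair (u, v)))) = (if track u = track v then 9 else 10)"
    using comparer_correct by blast
  ultimately show "\<exists>t \<le> 5 * pair_size p ^ 1 + 5. fst ((step comparer ^^ t) (initial comparer (encode_pair p))) =
      (if p \<in> word_problem automaton_semigroup act then accept comparer else reject comparer)"
    by (intro exI[of _ t]) (auto simp: p pair_size_def comparer_def simp del: step.simps)
qed

theorem mainTheorem1:
  shows
    "monoid automaton_semigroup \<and>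
     has_presentation automaton_semigroup act UNIV
       ({([F0, F0], [])} \<union>
        {([F1] @ word_power [F0, F1] p @ word_power [F1, F0] p @ [F1, F1],
          [F1] @ word_power [F0, F1] p @ word_power [F1, F0] p) | p. p \<ge> 0}) \<and>
     \<not> finitely_presented automaton_semigroup \<and>
     decidable_in_polynomial_time encode_pair pair_size (word_problem automaton_semigroup act) \<and>
     (\<forall>n\<ge>1. has_presentation (level_semigroup n) (act_level n) UNIV
       ({([F0, F0], [])} \<union>
        {([F1] @ word_power [F0, F1] p @ word_power [F1, F0] p @ [F1, F1],
          [F1] @ word_power [F0, F1] p @ word_power [F1, F0] p) | p. p + 2 \<le> n} \<union>
        {([F1] @ word_power [F0, F1] (n - 1) @ [F1], [F1] @ word_power [F0, F1] (n - 1)),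
         ([F1] @ word_power [F0, F1] (n - 1) @ [F0], [F1] @ word_power [F0, F1] (n - 1))}))"
proof (intro conjI allI impI)
  show "monoid automaton_semigroup" by (rule monoid_automaton_semigroup)
  have "{([F0, F0], [])} \<union>
      {([F1] @ word_power [F0, F1] p @ word_power [F1, F0] p @ [F1, F1],
        [F1] @ word_power [F0, F1] p @ word_power [F1, F0] p) | p. p \<ge> 0} =
    {([F0, F0], [])} \<union> range relator"
    unfolding relator_def by blast
  then show "has_presentation automaton_semigroup act UNIV
       ({([F0, F0], [])} \<union>
        {([F1] @ word_power [F0, F1] p @ word_power [F1, F0] p @ [F1, F1],
          [F1] @ word_power [F0, F1] p @ word_power [F1, F0] p) | p. p \<ge> 0})"
    using presentation_automaton_semigroup by (simp only:)
  show "\<not> finitely_presented automaton_semigroup" by (rule not_finitely_presented)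
  show "decidable_in_polynomial_time encode_pair pair_size (word_problem automaton_semigroup act)"
    by (rule word_problem_polynomial)
  fix n :: nat
  assume n: "1 \<le> n"
  have "{([F1] @ word_power [F0, F1] p @ word_power [F1, F0] p @ [F1, F1],
        [F1] @ word_power [F0, F1] p @ word_power [F1, F0] p) | p. p + 2 \<le> n} =
    relator ` {p. p + 2 \<le> n}"
    unfolding relator_def by blast
  then show "has_presentation (level_semigroup n) (act_level n) UNIV
       ({([F0, F0], [])} \<union>
        {([F1] @ word_power [F0, F1] p @ word_power [F1, F0] p @ [F1, F1],
          [F1] @ word_power [F0, F1] p @ word_power [F1, F0] p) | p. p + 2 \<le> n} \<union>
        {([F1] @ word_power [F0, F1] (n - 1) @ [F1], [F1] @ word_power [F0, F1] (n - 1)),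
         ([F1] @ word_power [F0, F1] (n - 1) @ [F0], [F1] @ word_power [F0, F1] (n - 1))})"
    using presentation_level_semigroup[OF n] by (simp only: append_assoc)
qed

end
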